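(* Let $(M,E)$ be a Finsler manifold. The h-curvature $R^{\star}$, hv-curvature $P^{\star}$ and v-curvature $Q^{\star}$ of the Hashiguchi connection $D^{\star}$ are given, for all $\zeta,\eta,\xi\in\mathfrak{X}(TM)$, by: (a) $R^{\star}(\zeta,\eta)\xi=R^{\circ}(\zeta,\eta)\xi+\mathcal{C}(F\mathfrak{R}(\zeta,\eta),\xi)$; (b) $P^{\star}(\zeta,\eta)\xi=P^{\circ}(\zeta,\eta)\xi+(D^{\star}_{h\zeta}\mathcal{C})(\eta,\xi)$; (c) $Q^{\star}(\zeta,\eta)\xi=Q(\zeta,\eta)\xi=\mathcal{C}(F\mathcal{C}(\zeta,\xi),\eta)-\mathcal{C}(F\mathcal{C}(\eta,\xi),\zeta)$, where $R^{\circ},P^{\circ}$ are the h- and hv-curvatures of the Berwald connection and $Q$ is the v-curvature of the Cartan connection.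
   Context: Setting. $M$ is an $n$-dimensional smooth manifold, $\mathcal{T}M=TM\setminus\{0\}$, and all objects "on $TM$" below (vector fields $\mathfrak{X}(TM)$, linear connections on $TM$, i.e. covariant derivatives of vector fields on $TM$) are considered over $\mathcal{T}M$, where they are smooth. In induced coordinates $(x^i,y^i)$, $J=\frac{\partial}{\partial y^i}\otimes dx^i$ is the almost tangent structure (so $\mathrm{Im}\,J=\ker J=V(TM)$, the vertical bundle) and $C=y^i\frac{\partial}{\partial y^i}$ is the Liouville vector field. A Finsler manifold $(M,E)$ is $M$ with $E:TM\to\mathbb{R}$ such that $E>0$ on $\mathcal{T}M$, $E(0)=0$, $E$ is smooth on $\mathcal{T}M$ and $C^1$ on $TM$, $\mathcal{L}_CE=2E$ (positively homogeneous of degree 2), and $\Omega:=dd_JE$ has maximal rank, where $d_JE(\zeta)=dE(J\zeta)$. The canonical spray $S$ is the unique vector field with $i_S\Omega=-dE$ ($JS=C$, $[C,S]=S$). The Barthel connection is $\Gamma=[J,S]$, i.e. $\Gamma\zeta=[J\zeta,S]-J[\zeta,S]$, with projectors $h=\frac12(I+\Gamma)$, $v=\frac12(I-\Gamma)$; the associated almost complex structure $F$ is defined by $FJ=h$, $Fh=-J$. The curvature of $\Gamma$ is $\mathfrak{R}=-\frac12[h,h]$ (Frölicher–Nijenhuis bracket), i.e. $\mathfrak{R}(\zeta,\eta)=-\big([h\zeta,h\eta]+h[\zeta,\eta]-h[h\zeta,\eta]-h[\zeta,h\eta]\big)$. The metric $g$ on $T(TM)$ is $g(\zeta,\xi)=\overline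 g(J\zeta,J\xi)+\overline g(v\zeta,v\xi)$ with $\overline g(J\zeta,J\xi)=\Omega(J\zeta,\xi)$. Cartan tensors $\mathcal{C},\mathcal{C}'$: the vertical-vector-valued tensors ($J\mathcal{C}=J\mathcal{C}'=0$) defined by $\Omega(\mathcal{C}(\zeta,\eta),\xi)=\frac12(\mathcal{L}_{J\zeta}(J^{*}g))(\eta,\xi)$, with $(J^{*}g)(\eta,\xi)=g(J\eta,J\xi)$, and $\Omega(\mathcal{C}'(\zeta,\eta),\xi)=\frac12(\mathcal{L}_{h\zeta}g)(J\eta,J\xi)$; both are symmetric and semi-basic (vanish if an argument is vertical), and vanish if an argument is $S$. Berwald connection $D^{\circ}$: $D^{\circ}_{J\zeta}J\xi=J[J\zeta,\xi]$, $D^{\circ}_{h\zeta}J\xi=v[h\zeta,J\xi]$, $D^{\circ}F=0$. Cartan connection $D$: $D_{J\zeta}J\xi=D^{\circ}_{J\zeta}J\xi+\mathcal{C}(\zeta,\xi)$, $D_{h\zeta}J\xi=D^{\circ}_{h\zeta}J\xi+\mathcal{C}'(\zeta,\xi)$, $DF=0$. Hashiguchi connection $D^{\star}$: the unique linear connection on $TM$ that is a lift of $\Gamma$ (that is, $D^{\star}J=0$, $D^{\star}_\zeta C=v\zeta$, $D^{\star}\Gamma=0$) and satisfies, for all $\zeta,\eta$: $D^{\star}_{J\eta}g=0$, $T^{\star}(J\zeta,J\eta)=0$, $v\,T^{\star}(h\zeta,J\eta)=0$, where $T^{\star}(\zeta,\eta)=D^{\star}_\zeta\eta-D^{\star}_\eta\zeta-[\zeta,\eta]$.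 For any of these connections $\nabla$, with classical curvature $K(\zeta,\eta)\xi=\nabla_\zeta\nabla_\eta\xi-\nabla_\eta\nabla_\zeta\xi-\nabla_{[\zeta,\eta]}\xi$, the h-, hv- and v-curvatures are respectively $(\zeta,\eta,\xi)\mapsto K(h\zeta,h\eta)J\xi$, $K(h\zeta,J\eta)J\xi$, $K(J\zeta,J\eta)J\xi$. Also $(D^{\star}_{\kappa}\mathcal{C})(\eta,\xi)=D^{\star}_\kappa(\mathcal{C}(\eta,\xi))-\mathcal{C}(D^{\star}_\kappa\eta,\xi)-\mathcal{C}(\eta,D^{\star}_\kappa\xi)$. *)

theory Defs
  imports "HOL-Analysis.Analysis" "HOL-Library.Function_Algebras"
begin

section \<open>Smooth maps between Euclidean spaces\<close>

text \<open>\<open>ck_on k S f\<close>: \<open>f\<close> is of class \<open>C\<^sup>k\<close> on the set \<open>S\<close>; only meant for open \<open>S\<close> in a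
  finite-dimensional space.\<close>

primrec ck_on ::
  "nat \<Rightarrow> 'a::real_normed_vector set \<Rightarrow> ('a \<Rightarrow> 'b::real_normed_vector) \<Rightarrow> bool" where
  "ck_on 0 S f \<longleftrightarrow> continuous_on S f"
| "ck_on (Suc k) S f \<longleftrightarrow>
     (\<forall>x\<in>S. f differentiable (at x)) \<and> (\<forall>v. ck_on k S (\<lambda>x. frechet_derivative f (at x) v))"

definition smooth_on :: "'a::real_normed_vector set \<Rightarrow> ('a \<Rightarrow> 'b::real_normed_vector) \<Rightarrow> bool" where
  "smooth_on S f \<longleftrightarrow> (\<forall>k. ck_on k S f)"


section \<open>Manifolds and vector fields\<close>

text \<open>A manifold is given by an atlas, i.e. a set of charts (domain, coordinate map) with values in
  a Euclidean space; its points are the points covered by the charts and its topology is the one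
  for which the charts are homeomorphisms onto their images.  A coordinate map is a total function
  of which only the values on the domain matter.\<close>

type_synonym ('a, 'e) chart = "'a set \<times> ('a \<Rightarrow> 'e)"

definition carrier :: "('a, 'e) chart set \<Rightarrow> 'a set" where
  "carrier A = \<Union> (fst ` A)"

definition chart_inv :: "('a, 'e) chart \<Rightarrow> 'e \<Rightarrow> 'a" where
  "chart_inv c = inv_into (fst c) (snd c)"

definition smooth_atlas :: "('a, 'e::euclidean_space) chart set \<Rightarrow> bool" where
  "smooth_atlas A \<longleftrightarrow>
     (\<forall>c\<in>A. inj_on (snd c) (fst c) \<and>
       (\<forall>c'\<in>A. open (snd c ` (fst c \<inter> fst c')) \<and>
               smooth_on (snd c ` (fst c \<inter> fst c')) (snd c' \<circ> chart_inv c)))"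

definition atlas_topology :: "('a, 'e::euclidean_space) chart set \<Rightarrow> 'a topology" where
  "atlas_topology A =
     topology (\<lambda>W. W \<subseteq> carrier A \<and> (\<forall>c\<in>A. open (snd c ` (W \<inter> fst c))))"

lemma openin_atlas_topology:
  assumes "smooth_atlas A"
  shows "openin (atlas_topology A) W \<longleftrightarrow>
           W \<subseteq> carrier A \<and> (\<forall>c\<in>A. open (snd c ` (W \<inter> fst c)))"
proof -
  let ?O = "\<lambda>W. W \<subseteq> carrier A \<and> (\<forall>c\<in>A. open (snd c ` (W \<inter> fst c)))"
  have "istopology ?O"
    unfolding istopology_def
  proof (intro conjI allI impI)
    fix V W assume V: "?O V" and W: "?O W"
    have "snd c ` (V \<inter> W \<inter> fst c) = snd c ` (V \<inter> fst c) \<inter> snd c ` (W \<inter> fst c)"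
      if "c \<in> A" for c
    proof -
      have "inj_on (snd c) (fst c)" using assms that by (auto simp: smooth_atlas_def)
      then show ?thesis by (auto simp: inj_on_def)
    qed
    then show "V \<inter> W \<subseteq> carrier A" "\<forall>c\<in>A. open (snd c ` (V \<inter> W \<inter> fst c))"
      using V W by auto
  next
    fix K assume K: "\<forall>W\<in>K. ?O W"
    have eq: "snd c ` (\<Union>K \<inter> fst c) = (\<Union>W\<in>K. snd c ` (W \<inter> fst c))"
      for c :: "('a, 'b) chart" by auto
    show "\<Union>K \<subseteq> carrier A" using K by auto
    show "\<forall>c\<in>A. open (snd c ` (\<Union>K \<inter> fst c))"
      using K by (simp add: eq open_UN)
  qed
  then show ?thesis by (simp add: atlas_topology_def topology_inverse')
qed

definition smooth_manifold :: "('a, 'e::euclidean_space) chart set \<Rightarrow> bool" where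
  "smooth_manifold A \<longleftrightarrow>
     smooth_atlas A \<and> Hausdorff_space (atlas_topology A) \<and> second_countable (atlas_topology A)"

definition ck_fun :: "nat \<Rightarrow> ('a, 'e::euclidean_space) chart set \<Rightarrow> ('a \<Rightarrow> real) \<Rightarrow> bool" where
  "ck_fun k A f \<longleftrightarrow> (\<forall>c\<in>A. ck_on k (snd c ` fst c) (f \<circ> chart_inv c))"

definition smooth_fun :: "('a, 'e::euclidean_space) chart set \<Rightarrow> ('a \<Rightarrow> real) \<Rightarrow> bool" where
  "smooth_fun A f \<longleftrightarrow> (\<forall>k. ck_fun k A f)"

text \<open>A tangent vector at \<open>p\<close> is the family of its coordinate representatives in all charts around
  \<open>p\<close>, related by the derivatives of the transition maps.  It is set to \<open>0\<close> at all other charts,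
  so that tangent vectors, and vector fields below, are equal iff they have the same
  representatives.\<close>

type_synonym ('a, 'e) tvec = "('a, 'e) chart \<Rightarrow> 'e"
type_synonym ('a, 'e) vfield = "'a \<Rightarrow> ('a, 'e) tvec"

definition tangent_space ::
  "('a, 'e::euclidean_space) chart set \<Rightarrow> 'a \<Rightarrow> ('a, 'e) tvec set" where
  "tangent_space A p = {w.
     (\<forall>c\<in>A. \<forall>c'\<in>A. p \<in> fst c \<inter> fst c' \<longrightarrow>
        w c' = frechet_derivative (snd c' \<circ> chart_inv c) (at (snd c p)) (w c)) \<and>
     (\<forall>c. \<not> (c \<in> A \<and> p \<in> fst c) \<longrightarrow> w c = 0)}"

definition rep :: "('a, 'e) chart \<Rightarrow> ('a, 'e) vfield \<Rightarrow> 'e \<Rightarrow> 'e" where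
  "rep c X = (\<lambda>z. X (chart_inv c z) c)"

definition vector_fields :: "('a, 'e::euclidean_space) chart set \<Rightarrow> ('a, 'e) vfield set" where
  "vector_fields A = {X. (\<forall>p. X p \<in> tangent_space A p) \<and>
                         (\<forall>c\<in>A. smooth_on (snd c ` fst c) (rep c X))}"

text \<open>Sums and differences of vector fields are those of \<^theory>\<open>HOL-Library.Function_Algebras\<close>.\<close>

definition fmult :: "('a \<Rightarrow> real) \<Rightarrow> ('a, 'e::euclidean_space) vfield \<Rightarrow> ('a, 'e) vfield" where
  "fmult f X = (\<lambda>p c. f p *\<^sub>R X p c)"

text \<open>\<open>deriv_along A X f\<close> is \<open>X f = df(X)\<close>; on the carrier of \<open>A\<close> the value does not depend on the
  chart chosen.\<close>

definition deriv_along ::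
  "('a, 'e::euclidean_space) chart set \<Rightarrow> ('a, 'e) vfield \<Rightarrow> ('a \<Rightarrow> real) \<Rightarrow> 'a \<Rightarrow> real" where
  "deriv_along A X f p =
     (let c = (SOME c. c \<in> A \<and> p \<in> fst c)
      in frechet_derivative (f \<circ> chart_inv c) (at (snd c p)) (X p c))"

definition lie_bracket ::
  "('a, 'e::euclidean_space) chart set \<Rightarrow> ('a, 'e) vfield \<Rightarrow> ('a, 'e) vfield \<Rightarrow> ('a, 'e) vfield" where
  "lie_bracket A X Y = (\<lambda>p c.
     if c \<in> A \<and> p \<in> fst c
     then frechet_derivative (rep c Y) (at (snd c p)) (X p c) -
          frechet_derivative (rep c X) (at (snd c p)) (Y p c)
     else 0)"


section \<open>Tensor fields and linear connections\<close>

text \<open>Tensor fields are represented by the corresponding multilinear maps on vector fields, over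
  the ring of smooth functions.\<close>

definition tensor11 ::
  "('a, 'e::euclidean_space) chart set \<Rightarrow> (('a, 'e) vfield \<Rightarrow> ('a, 'e) vfield) \<Rightarrow> bool" where
  "tensor11 A T \<longleftrightarrow>
     (\<forall>X\<in>vector_fields A. T X \<in> vector_fields A) \<and>
     (\<forall>X\<in>vector_fields A. \<forall>Y\<in>vector_fields A. T (X + Y) = T X + T Y) \<and>
     (\<forall>f. \<forall>X\<in>vector_fields A. smooth_fun A f \<longrightarrow> T (fmult f X) = fmult f (T X))"

definition tensor12 ::
  "('a, 'e::euclidean_space) chart set \<Rightarrow>
   (('a, 'e) vfield \<Rightarrow> ('a, 'e) vfield \<Rightarrow> ('a, 'e) vfield) \<Rightarrow> bool" where
  "tensor12 A T \<longleftrightarrow>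
     (\<forall>X\<in>vector_fields A. tensor11 A (\<lambda>Y. T X Y)) \<and>
     (\<forall>Y\<in>vector_fields A. tensor11 A (\<lambda>X. T X Y))"

text \<open>The value of a 2-form at \<open>p\<close> is read off on vector fields evaluated at \<open>p\<close> (every tangent
  vector at \<open>p\<close> is the value of a vector field); maximal rank means nondegeneracy at every point.\<close>

definition maximal_rank ::
  "('a, 'e::euclidean_space) chart set \<Rightarrow>
   (('a, 'e) vfield \<Rightarrow> ('a, 'e) vfield \<Rightarrow> 'a \<Rightarrow> real) \<Rightarrow> bool" where
  "maximal_rank A b \<longleftrightarrow>
     (\<forall>p\<in>carrier A. \<forall>X\<in>vector_fields A. (\<forall>Y\<in>vector_fields A. b X Y p = 0) \<longrightarrow> X p = 0)"

definition ext_deriv ::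
  "('a, 'e::euclidean_space) chart set \<Rightarrow> (('a, 'e) vfield \<Rightarrow> 'a \<Rightarrow> real) \<Rightarrow>
   ('a, 'e) vfield \<Rightarrow> ('a, 'e) vfield \<Rightarrow> 'a \<Rightarrow> real" where
  "ext_deriv A \<theta> X Y =
     deriv_along A X (\<theta> Y) - deriv_along A Y (\<theta> X) - \<theta> (lie_bracket A X Y)"

definition lie_deriv02 ::
  "('a, 'e::euclidean_space) chart set \<Rightarrow> ('a, 'e) vfield \<Rightarrow>
   (('a, 'e) vfield \<Rightarrow> ('a, 'e) vfield \<Rightarrow> 'a \<Rightarrow> real) \<Rightarrow>
   ('a, 'e) vfield \<Rightarrow> ('a, 'e) vfield \<Rightarrow> 'a \<Rightarrow> real" where
  "lie_deriv02 A X b Y Z =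
     deriv_along A X (b Y Z) - b (lie_bracket A X Y) Z - b Y (lie_bracket A X Z)"

type_synonym ('a, 'e) connection = "('a, 'e) vfield \<Rightarrow> ('a, 'e) vfield \<Rightarrow> ('a, 'e) vfield"

definition linear_connection ::
  "('a, 'e::euclidean_space) chart set \<Rightarrow> ('a, 'e) connection \<Rightarrow> bool" where
  "linear_connection A D \<longleftrightarrow>
     (\<forall>Y\<in>vector_fields A. tensor11 A (\<lambda>X. D X Y)) \<and>
     (\<forall>X\<in>vector_fields A. \<forall>Y\<in>vector_fields A. \<forall>Z\<in>vector_fields A.
        D X (Y + Z) = D X Y + D X Z) \<and>
     (\<forall>f. \<forall>X\<in>vector_fields A. \<forall>Y\<in>vector_fields A. smooth_fun A f \<longrightarrow>
        D X (fmult f Y) = fmult (deriv_along A X f) Y + fmult f (D X Y))"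

definition cov_deriv11 ::
  "('a, 'e) connection \<Rightarrow> ('a, 'e::euclidean_space) vfield \<Rightarrow>
   (('a, 'e) vfield \<Rightarrow> ('a, 'e) vfield) \<Rightarrow> ('a, 'e) vfield \<Rightarrow> ('a, 'e) vfield" where
  "cov_deriv11 D X T Y = D X (T Y) - T (D X Y)"

definition cov_deriv12 ::
  "('a, 'e) connection \<Rightarrow> ('a, 'e::euclidean_space) vfield \<Rightarrow>
   (('a, 'e) vfield \<Rightarrow> ('a, 'e) vfield \<Rightarrow> ('a, 'e) vfield) \<Rightarrow>
   ('a, 'e) vfield \<Rightarrow> ('a, 'e) vfield \<Rightarrow> ('a, 'e) vfield" where
  "cov_deriv12 D X T Y Z = D X (T Y Z) - T (D X Y) Z - T Y (D X Z)"

definition cov_deriv02 ::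
  "('a, 'e::euclidean_space) chart set \<Rightarrow> ('a, 'e) connection \<Rightarrow> ('a, 'e) vfield \<Rightarrow>
   (('a, 'e) vfield \<Rightarrow> ('a, 'e) vfield \<Rightarrow> 'a \<Rightarrow> real) \<Rightarrow>
   ('a, 'e) vfield \<Rightarrow> ('a, 'e) vfield \<Rightarrow> 'a \<Rightarrow> real" where
  "cov_deriv02 A D X b Y Z = deriv_along A X (b Y Z) - b (D X Y) Z - b Y (D X Z)"

definition torsion ::
  "('a, 'e::euclidean_space) chart set \<Rightarrow> ('a, 'e) connection \<Rightarrow>
   ('a, 'e) vfield \<Rightarrow> ('a, 'e) vfield \<Rightarrow> ('a, 'e) vfield" where
  "torsion A D X Y = D X Y - D Y X - lie_bracket A X Y"

definition curvature ::
  "('a, 'e::euclidean_space) chart set \<Rightarrow> ('a, 'e) connection \<Rightarrow>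
   ('a, 'e) vfield \<Rightarrow> ('a, 'e) vfield \<Rightarrow> ('a, 'e) vfield \<Rightarrow> ('a, 'e) vfield" where
  "curvature A D X Y Z = D X (D Y Z) - D Y (D X Z) - D (lie_bracket A X Y) Z"


section \<open>The tangent bundle\<close>

type_synonym ('m, 'e) tpoint = "'m \<times> ('m, 'e) tvec"

text \<open>The induced coordinates \<open>(x, y)\<close> on \<open>TM\<close>, and their restriction to the slit tangent bundle.\<close>

definition tangent_chart ::
  "('m, 'e::euclidean_space) chart set \<Rightarrow> ('m, 'e) chart \<Rightarrow> (('m, 'e) tpoint, 'e \<times> 'e) chart" where
  "tangent_chart A c =
     ({(p, w). p \<in> fst c \<and> w \<in> tangent_space A p}, \<lambda>(p, w). (snd c p, w c))"

definition slit_chart ::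
  "('m, 'e::euclidean_space) chart set \<Rightarrow> ('m, 'e) chart \<Rightarrow> (('m, 'e) tpoint, 'e \<times> 'e) chart" where
  "slit_chart A c =
     ({(p, w). p \<in> fst c \<and> w \<in> tangent_space A p \<and> w \<noteq> 0}, \<lambda>(p, w). (snd c p, w c))"

definition tangent_atlas ::
  "('m, 'e::euclidean_space) chart set \<Rightarrow> (('m, 'e) tpoint, 'e \<times> 'e) chart set" where
  "tangent_atlas A = tangent_chart A ` A"

definition slit_atlas ::
  "('m, 'e::euclidean_space) chart set \<Rightarrow> (('m, 'e) tpoint, 'e \<times> 'e) chart set" where
  "slit_atlas A = slit_chart A ` A"

text \<open>From here on \<open>A\<close> is the atlas of \<open>M\<close>, and fields live on the slit tangent bundle.\<close>

type_synonym ('m, 'e) tfield = "(('m, 'e) tpoint, 'e \<times> 'e) vfield"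
type_synonym ('m, 'e) tconn = "(('m, 'e) tpoint, 'e \<times> 'e) connection"

abbreviation slit_fields :: "('m, 'e::euclidean_space) chart set \<Rightarrow> ('m, 'e) tfield set" where
  "slit_fields A \<equiv> vector_fields (slit_atlas A)"

abbreviation slit_bracket ::
  "('m, 'e::euclidean_space) chart set \<Rightarrow> ('m, 'e) tfield \<Rightarrow> ('m, 'e) tfield \<Rightarrow> ('m, 'e) tfield" where
  "slit_bracket A \<equiv> lie_bracket (slit_atlas A)"

text \<open>\<open>J = \<partial>/\<partial>y\<^sup>i \<otimes> dx\<^sup>i\<close> and \<open>C = y\<^sup>i \<partial>/\<partial>y\<^sup>i\<close> in induced coordinates.\<close>

definition tangent_J :: "('m, 'e::euclidean_space) tfield \<Rightarrow> ('m, 'e) tfield" where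
  "tangent_J X = (\<lambda>u c. (0, fst (X u c)))"

definition liouville :: "('m, 'e::euclidean_space) chart set \<Rightarrow> ('m, 'e) tfield" where
  "liouville A = (\<lambda>u c. if c \<in> slit_atlas A \<and> u \<in> fst c then (0, snd (snd c u)) else 0)"


section \<open>Finsler manifolds\<close>

definition d_J ::
  "('m, 'e::euclidean_space) chart set \<Rightarrow> (('m, 'e) tpoint \<Rightarrow> real) \<Rightarrow>
   ('m, 'e) tfield \<Rightarrow> ('m, 'e) tpoint \<Rightarrow> real" where
  "d_J A E X = deriv_along (slit_atlas A) (tangent_J X) E"

definition fundamental_form ::
  "('m, 'e::euclidean_space) chart set \<Rightarrow> (('m, 'e) tpoint \<Rightarrow> real) \<Rightarrow>
   ('m, 'e) tfield \<Rightarrow> ('m, 'e) tfield \<Rightarrow> ('m, 'e) tpoint \<Rightarrow> real" where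
  "fundamental_form A E = ext_deriv (slit_atlas A) (d_J A E)"

definition finsler_manifold ::
  "('m, 'e::euclidean_space) chart set \<Rightarrow> (('m, 'e) tpoint \<Rightarrow> real) \<Rightarrow> bool" where
  "finsler_manifold A E \<longleftrightarrow>
     smooth_manifold A \<and>
     (\<forall>u\<in>carrier (slit_atlas A). E u > 0) \<and>
     (\<forall>p\<in>carrier A. E (p, 0) = 0) \<and>
     smooth_fun (slit_atlas A) E \<and>
     ck_fun 1 (tangent_atlas A) E \<and>
     (\<forall>u\<in>carrier (slit_atlas A). deriv_along (slit_atlas A) (liouville A) E u = 2 * E u) \<and>
     maximal_rank (slit_atlas A) (fundamental_form A E)"

definition canonical_spray ::
  "('m, 'e::euclidean_space) chart set \<Rightarrow> (('m, 'e) tpoint \<Rightarrow> real) \<Rightarrow> ('m, 'e) tfield \<Rightarrow> bool" where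
  "canonical_spray A E S \<longleftrightarrow>
     S \<in> slit_fields A \<and>
     (\<forall>X\<in>slit_fields A. \<forall>u\<in>carrier (slit_atlas A).
        fundamental_form A E S X u = - deriv_along (slit_atlas A) X E u)"

definition barthel ::
  "('m, 'e::euclidean_space) chart set \<Rightarrow> ('m, 'e) tfield \<Rightarrow> ('m, 'e) tfield \<Rightarrow> ('m, 'e) tfield" where
  "barthel A S X = slit_bracket A (tangent_J X) S - tangent_J (slit_bracket A X S)"

definition hor ::
  "('m, 'e::euclidean_space) chart set \<Rightarrow> ('m, 'e) tfield \<Rightarrow> ('m, 'e) tfield \<Rightarrow> ('m, 'e) tfield" where
  "hor A S X = fmult (\<lambda>_. 1/2) (X + barthel A S X)"

definition ver ::
  "('m, 'e::euclidean_space) chart set \<Rightarrow> ('m, 'e) tfield \<Rightarrow> ('m, 'e) tfield \<Rightarrow> ('m, 'e) tfield" where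
  "ver A S X = fmult (\<lambda>_. 1/2) (X - barthel A S X)"

definition almost_complex_structure ::
  "('m, 'e::euclidean_space) chart set \<Rightarrow> ('m, 'e) tfield \<Rightarrow>
   (('m, 'e) tfield \<Rightarrow> ('m, 'e) tfield) \<Rightarrow> bool" where
  "almost_complex_structure A S F \<longleftrightarrow>
     tensor11 (slit_atlas A) F \<and>
     (\<forall>X\<in>slit_fields A. F (tangent_J X) = hor A S X \<and> F (hor A S X) = - tangent_J X)"

definition barthel_curvature ::
  "('m, 'e::euclidean_space) chart set \<Rightarrow> ('m, 'e) tfield \<Rightarrow>
   ('m, 'e) tfield \<Rightarrow> ('m, 'e) tfield \<Rightarrow> ('m, 'e) tfield" where
  "barthel_curvature A S X Y =
     - (slit_bracket A (hor A S X) (hor A S Y) + hor A S (slit_bracket A X Y)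
        - hor A S (slit_bracket A (hor A S X) Y) - hor A S (slit_bracket A X (hor A S Y)))"

text \<open>The metric on the vertical bundle, \<open>(J X, J Y) \<mapsto> \<Omega>(J X, Y)\<close>.  The second argument is
  represented as \<open>J Z\<close>; the value does not depend on \<open>Z\<close> because \<open>\<Omega>\<close> vanishes on pairs of
  vertical fields.\<close>

definition vertical_metric ::
  "('m, 'e::euclidean_space) chart set \<Rightarrow> (('m, 'e) tpoint \<Rightarrow> real) \<Rightarrow>
   ('m, 'e) tfield \<Rightarrow> ('m, 'e) tfield \<Rightarrow> ('m, 'e) tpoint \<Rightarrow> real" where
  "vertical_metric A E V W =
     fundamental_form A E V (SOME Z. Z \<in> slit_fields A \<and> tangent_J Z = W)"

definition metric ::
  "('m, 'e::euclidean_space) chart set \<Rightarrow> (('m, 'e) tpoint \<Rightarrow> real) \<Rightarrow> ('m, 'e) tfield \<Rightarrow>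
   ('m, 'e) tfield \<Rightarrow> ('m, 'e) tfield \<Rightarrow> ('m, 'e) tpoint \<Rightarrow> real" where
  "metric A E S X Y =
     vertical_metric A E (tangent_J X) (tangent_J Y) + vertical_metric A E (ver A S X) (ver A S Y)"


section \<open>Cartan tensors\<close>

definition first_cartan_tensor ::
  "('m, 'e::euclidean_space) chart set \<Rightarrow> (('m, 'e) tpoint \<Rightarrow> real) \<Rightarrow> ('m, 'e) tfield \<Rightarrow>
   (('m, 'e) tfield \<Rightarrow> ('m, 'e) tfield \<Rightarrow> ('m, 'e) tfield) \<Rightarrow> bool" where
  "first_cartan_tensor A E S C \<longleftrightarrow>
     tensor12 (slit_atlas A) C \<and>
     (\<forall>X\<in>slit_fields A. \<forall>Y\<in>slit_fields A. tangent_J (C X Y) = 0 \<and>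
       (\<forall>Z\<in>slit_fields A. \<forall>u\<in>carrier (slit_atlas A).
          fundamental_form A E (C X Y) Z u =
            1/2 * lie_deriv02 (slit_atlas A) (tangent_J X)
                    (\<lambda>Y Z. metric A E S (tangent_J Y) (tangent_J Z)) Y Z u))"

definition second_cartan_tensor ::
  "('m, 'e::euclidean_space) chart set \<Rightarrow> (('m, 'e) tpoint \<Rightarrow> real) \<Rightarrow> ('m, 'e) tfield \<Rightarrow>
   (('m, 'e) tfield \<Rightarrow> ('m, 'e) tfield \<Rightarrow> ('m, 'e) tfield) \<Rightarrow> bool" where
  "second_cartan_tensor A E S C' \<longleftrightarrow>
     tensor12 (slit_atlas A) C' \<and>
     (\<forall>X\<in>slit_fields A. \<forall>Y\<in>slit_fields A. tangent_J (C' X Y) = 0 \<and>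
       (\<forall>Z\<in>slit_fields A. \<forall>u\<in>carrier (slit_atlas A).
          fundamental_form A E (C' X Y) Z u =
            1/2 * lie_deriv02 (slit_atlas A) (hor A S X) (metric A E S)
                    (tangent_J Y) (tangent_J Z) u))"


section \<open>The Berwald, Cartan and Hashiguchi connections\<close>

definition berwald_connection ::
  "('m, 'e::euclidean_space) chart set \<Rightarrow> ('m, 'e) tfield \<Rightarrow>
   (('m, 'e) tfield \<Rightarrow> ('m, 'e) tfield) \<Rightarrow> ('m, 'e) tconn \<Rightarrow> bool" where
  "berwald_connection A S F D \<longleftrightarrow>
     linear_connection (slit_atlas A) D \<and>
     (\<forall>X\<in>slit_fields A. \<forall>Y\<in>slit_fields A.
        D (tangent_J X) (tangent_J Y) = tangent_J (slit_bracket A (tangent_J X) Y) \<and>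
        D (hor A S X) (tangent_J Y) = ver A S (slit_bracket A (hor A S X) (tangent_J Y)) \<and>
        cov_deriv11 D X F Y = 0)"

definition cartan_connection ::
  "('m, 'e::euclidean_space) chart set \<Rightarrow> ('m, 'e) tfield \<Rightarrow>
   (('m, 'e) tfield \<Rightarrow> ('m, 'e) tfield) \<Rightarrow>
   (('m, 'e) tfield \<Rightarrow> ('m, 'e) tfield \<Rightarrow> ('m, 'e) tfield) \<Rightarrow>
   (('m, 'e) tfield \<Rightarrow> ('m, 'e) tfield \<Rightarrow> ('m, 'e) tfield) \<Rightarrow>
   ('m, 'e) tconn \<Rightarrow> ('m, 'e) tconn \<Rightarrow> bool" where
  "cartan_connection A S F C C' D0 D \<longleftrightarrow>
     linear_connection (slit_atlas A) D \<and>
     (\<forall>X\<in>slit_fields A. \<forall>Y\<in>slit_fields A.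
        D (tangent_J X) (tangent_J Y) = D0 (tangent_J X) (tangent_J Y) + C X Y \<and>
        D (hor A S X) (tangent_J Y) = D0 (hor A S X) (tangent_J Y) + C' X Y \<and>
        cov_deriv11 D X F Y = 0)"

definition lift_of_barthel ::
  "('m, 'e::euclidean_space) chart set \<Rightarrow> ('m, 'e) tfield \<Rightarrow> ('m, 'e) tconn \<Rightarrow> bool" where
  "lift_of_barthel A S D \<longleftrightarrow>
     linear_connection (slit_atlas A) D \<and>
     (\<forall>X\<in>slit_fields A. \<forall>Y\<in>slit_fields A.
        cov_deriv11 D X tangent_J Y = 0 \<and>
        D X (liouville A) = ver A S X \<and>
        cov_deriv11 D X (barthel A S) Y = 0)"

definition hashiguchi_connection ::
  "('m, 'e::euclidean_space) chart set \<Rightarrow> (('m, 'e) tpoint \<Rightarrow> real) \<Rightarrow> ('m, 'e) tfield \<Rightarrow>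
   ('m, 'e) tconn \<Rightarrow> bool" where
  "hashiguchi_connection A E S D \<longleftrightarrow>
     lift_of_barthel A S D \<and>
     (\<forall>X\<in>slit_fields A. \<forall>Y\<in>slit_fields A.
        (\<forall>Z\<in>slit_fields A. \<forall>u\<in>carrier (slit_atlas A).
           cov_deriv02 (slit_atlas A) D (tangent_J X) (metric A E S) Y Z u = 0) \<and>
        torsion (slit_atlas A) D (tangent_J X) (tangent_J Y) = 0 \<and>
        ver A S (torsion (slit_atlas A) D (hor A S X) (tangent_J Y)) = 0)"

definition h_curvature ::
  "('m, 'e::euclidean_space) chart set \<Rightarrow> ('m, 'e) tfield \<Rightarrow> ('m, 'e) tconn \<Rightarrow>
   ('m, 'e) tfield \<Rightarrow> ('m, 'e) tfield \<Rightarrow> ('m, 'e) tfield \<Rightarrow> ('m, 'e) tfield" where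
  "h_curvature A S D X Y Z =
     curvature (slit_atlas A) D (hor A S X) (hor A S Y) (tangent_J Z)"

definition hv_curvature ::
  "('m, 'e::euclidean_space) chart set \<Rightarrow> ('m, 'e) tfield \<Rightarrow> ('m, 'e) tconn \<Rightarrow>
   ('m, 'e) tfield \<Rightarrow> ('m, 'e) tfield \<Rightarrow> ('m, 'e) tfield \<Rightarrow> ('m, 'e) tfield" where
  "hv_curvature A S D X Y Z =
     curvature (slit_atlas A) D (hor A S X) (tangent_J Y) (tangent_J Z)"

definition v_curvature ::
  "('m, 'e::euclidean_space) chart set \<Rightarrow> ('m, 'e) tconn \<Rightarrow>
   ('m, 'e) tfield \<Rightarrow> ('m, 'e) tfield \<Rightarrow> ('m, 'e) tfield \<Rightarrow> ('m, 'e) tfield" where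
  "v_curvature A D X Y Z =
     curvature (slit_atlas A) D (tangent_J X) (tangent_J Y) (tangent_J Z)"

end

(*  In induced coordinates the vertical metric is the vertical Hessian of E, and the Berwald connection
    differentiates vertical fields along vertical fields as a flat space would.  Homogeneity of E
    turns i_S Omega = -dE into JS = C, which yields the projector algebra of h and v.

    The Hashiguchi connection agrees with the Berwald connection on vertical fields along horizontal
    fields (mixed torsion condition), and differs from it by the first Cartan tensor along vertical
    fields (a Koszul argument, since the connection is vertically metric and torsion free).  Parts (a)
    and (b) follow by splitting the brackets [hX, hY] and [hX, JY] into horizontal and vertical parts.
    For (c), write N for the flat vertical Berwald derivative.  The connection is N + C there, and
    since N g = 2 g C and the fourth vertical derivative of E is symmetric, the antisymmetric part of
    N C is -2 [C, C]; hence the curvature of N + C is -2 [C, C] + [C, C] = -[C, C]. *)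

theory Submission
  imports Defs
begin

section \<open>Calculus on open sets of a Euclidean space\<close>

text \<open>Fields are global maps, and neither local frames nor partitions of unity are used. An
  identity between fields is reached by pairing both sides under \<Omega> with an arbitrary field,
  which maximal rank permits. The obstacle is that the connection rules and the metric speak of
  fields of the form JY, so a vertical field needs a global preimage under J. For vertical X the
  field [X, S] is one as soon as JS is the Liouville field; hence homogeneity of E has to be
  exploited before anything is said about h and v. Later F takes over this task, because JF is the
  identity on vertical fields; the terms \<open>Ct (F (Ct X Z)) Y\<close> in (c) come from exactly
  this re-encoding. Induced coordinates are confined to the calculus of brackets and derivations and
  to the identities relating J, the Liouville field and the bracket. Their main analytic input is
  the symmetry of second derivatives, obtained from difference quotients.\<close>

lemma has_frechet_derivative:
  "f differentiable (at x) \<Longrightarrow> (f has_derivative frechet_derivative f (at x)) (at x)"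
  by (simp add: frechet_derivative_works[symmetric])

lemma frechet_derivative_eqI:
  "(f has_derivative f') (at x) \<Longrightarrow> frechet_derivative f (at x) = f'"
  using frechet_derivative_at by fastforce

lemma frechet_derivative_cong_open:
  assumes "open S" "x \<in> S" "\<And>y. y \<in> S \<Longrightarrow> f y = g y"
  shows "frechet_derivative f (at x) = frechet_derivative g (at x)"
proof -
  have "(f has_derivative D) (at x) \<longleftrightarrow> (g has_derivative D) (at x)" for D
    using assms by (metis has_derivative_transform_within_open)
  then show ?thesis by (simp add: frechet_derivative_def)
qed

lemma differentiable_cong_open:
  assumes "open S" "x \<in> S" "\<And>y. y \<in> S \<Longrightarrow> f y = g y"
  shows "f differentiable (at x) \<longleftrightarrow> g differentiable (at x)"
  using assms by (metis differentiable_def has_derivative_transform_within_open)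

section \<open>Closure properties of C^k and smooth maps\<close>

lemma ck_on_cong:
  assumes "open S" "\<And>y. y \<in> S \<Longrightarrow> f y = g y" "ck_on k S f"
  shows "ck_on k S g"
  using assms(2,3)
proof (induction k arbitrary: f g)
  case 0
  then show ?case by (simp cong: continuous_on_cong)
next
  case (Suc k)
  have "f differentiable at x \<longleftrightarrow> g differentiable at x" if "x \<in> S" for x
    using assms(1) that Suc.prems(1) by (rule differentiable_cong_open)
  moreover have "ck_on k S (\<lambda>x. frechet_derivative g (at x) v)" for v
  proof (rule Suc.IH)
    show "ck_on k S (\<lambda>x. frechet_derivative f (at x) v)" using Suc.prems by simp
    show "frechet_derivative f (at y) v = frechet_derivative g (at y) v" if "y \<in> S" for y
      using frechet_derivative_cong_open[OF assms(1) that Suc.prems(1)] by simp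
  qed
  ultimately show ?case using Suc.prems by auto
qed

lemma ck_on_Suc_imp:
  "ck_on (Suc k) S f \<Longrightarrow> ck_on k S f"
proof (induction k arbitrary: f)
  case 0
  then show ?case
    by (auto intro!: continuous_at_imp_continuous_on differentiable_imp_continuous_within)
next
  case (Suc k)
  then show ?case by (metis ck_on.simps(2))
qed

lemma smooth_on_cong:
  "\<lbrakk>smooth_on S f; open S; \<And>y. y \<in> S \<Longrightarrow> f y = g y\<rbrakk> \<Longrightarrow> smooth_on S g"
  unfolding smooth_on_def using ck_on_cong by blast

lemma smooth_on_differentiable: "smooth_on S f \<Longrightarrow> x \<in> S \<Longrightarrow> f differentiable (at x)"
  unfolding smooth_on_def by (metis ck_on.simps(2))

lemma smooth_on_frechet: "smooth_on S f \<Longrightarrow> smooth_on S (\<lambda>x. frechet_derivative f (at x) v)"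
  unfolding smooth_on_def by (metis ck_on.simps(2))

lemma smooth_on_const: "smooth_on S (\<lambda>_. c)"
proof -
  have "ck_on k S (\<lambda>_. c)" for k by (induction k arbitrary: c) auto
  then show ?thesis by (simp add: smooth_on_def)
qed

lemma ck_on_bounded_linear:
  assumes "open S" "bounded_linear L" "ck_on k S f"
  shows "ck_on k S (\<lambda>x. L (f x))"
  using assms(3)
proof (induction k arbitrary: f)
  case 0
  then show ?case using assms(2) by (simp add: bounded_linear.continuous_on)
next
  case (Suc k)
  have D: "((\<lambda>x. L (f x)) has_derivative (\<lambda>v. L (frechet_derivative f (at x) v))) (at x)"
    if "x \<in> S" for x
    using bounded_linear.has_derivative[OF assms(2) has_frechet_derivative] Suc.prems that by auto
  have "ck_on k S (\<lambda>x. frechet_derivative (\<lambda>x. L (f x)) (at x) v)" for v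
  proof (rule ck_on_cong[OF assms(1)])
    show "ck_on k S (\<lambda>x. L (frechet_derivative f (at x) v))"
      using Suc by simp
  qed (simp add: frechet_derivative_eqI[OF D])
  then show ?case using D unfolding differentiable_def ck_on.simps by blast
qed

lemma smooth_on_bounded_linear:
  "\<lbrakk>smooth_on S f; open S; bounded_linear L\<rbrakk> \<Longrightarrow> smooth_on S (\<lambda>x. L (f x))"
  unfolding smooth_on_def using ck_on_bounded_linear by blast

lemma ck_on_add:
  assumes "open S" "ck_on k S f" "ck_on k S g"
  shows "ck_on k S (\<lambda>x. f x + g x)"
  using assms(2,3)
proof (induction k arbitrary: f g)
  case 0
  then show ?case by (simp add: continuous_on_add)
next
  case (Suc k)
  have D: "((\<lambda>x. f x + g x) has_derivative
      (\<lambda>v. frechet_derivative f (at x) v + frechet_derivative g (at x) v)) (at x)"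
    if "x \<in> S" for x
    using Suc.prems that by (auto intro!: has_derivative_add has_frechet_derivative)
  have "ck_on k S (\<lambda>x. frechet_derivative (\<lambda>x. f x + g x) (at x) v)" for v
  proof (rule ck_on_cong[OF assms(1)])
    show "ck_on k S (\<lambda>x. frechet_derivative f (at x) v + frechet_derivative g (at x) v)"
      using Suc.prems by (intro Suc.IH) auto
  qed (simp add: frechet_derivative_eqI[OF D])
  then show ?case using D unfolding differentiable_def ck_on.simps by blast
qed

lemma smooth_on_add:
  "\<lbrakk>smooth_on S f; smooth_on S g; open S\<rbrakk> \<Longrightarrow> smooth_on S (\<lambda>x. f x + g x)"
  unfolding smooth_on_def using ck_on_add by blast

lemma smooth_on_diff:
  assumes "smooth_on S f" "smooth_on S g" "open S"
  shows "smooth_on S (\<lambda>x. f x - g x)"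
  using smooth_on_add[OF assms(1) smooth_on_bounded_linear[OF assms(2,3), of uminus] assms(3)]
  by (simp add: bounded_linear_minus bounded_linear_ident)

text \<open>The product rule leaves one factor undifferentiated, so the induction also needs both
  factors themselves one order lower, which \<open>ck_on_Suc_imp\<close> supplies.\<close>

lemma ck_on_scaleR:
  fixes f :: "'a::real_normed_vector \<Rightarrow> real" and g :: "'a \<Rightarrow> 'b::real_normed_vector"
  assumes "open S" "ck_on k S f" "ck_on k S g"
  shows "ck_on k S (\<lambda>x. f x *\<^sub>R g x)"
  using assms(2,3)
proof (induction k arbitrary: f g)
  case 0
  then show ?case by (simp add: continuous_on_scaleR)
next
  case (Suc k)
  have D: "((\<lambda>x. f x *\<^sub>R g x) has_derivative
      (\<lambda>v. f x *\<^sub>R frechet_derivative g (at x) v + frechet_derivative f (at x) v *\<^sub>R g x)) (at x)"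
    if "x \<in> S" for x
    using Suc.prems that by (auto intro!: has_derivative_scaleR has_frechet_derivative)
  have "ck_on k S (\<lambda>x. frechet_derivative (\<lambda>x. f x *\<^sub>R g x) (at x) v)" for v
  proof (rule ck_on_cong[OF assms(1)])
    show "ck_on k S (\<lambda>x. f x *\<^sub>R frechet_derivative g (at x) v + frechet_derivative f (at x) v *\<^sub>R g x)"
      using Suc.prems ck_on_Suc_imp[OF Suc.prems(1)] ck_on_Suc_imp[OF Suc.prems(2)]
      by (intro ck_on_add assms(1) Suc.IH) auto
  qed (simp add: frechet_derivative_eqI[OF D])
  then show ?case using D unfolding differentiable_def ck_on.simps by blast
qed

lemma smooth_on_scaleR:
  fixes f :: "'a::real_normed_vector \<Rightarrow> real" and g :: "'a \<Rightarrow> 'b::real_normed_vector"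
  shows "\<lbrakk>smooth_on S f; smooth_on S g; open S\<rbrakk> \<Longrightarrow> smooth_on S (\<lambda>x. f x *\<^sub>R g x)"
  unfolding smooth_on_def using ck_on_scaleR by blast

lemma smooth_on_sum:
  "\<lbrakk>finite I; open S; \<And>i. i \<in> I \<Longrightarrow> smooth_on S (f i)\<rbrakk> \<Longrightarrow> smooth_on S (\<lambda>x. \<Sum>i\<in>I. f i x)"
  by (induction I rule: finite_induct) (auto intro: smooth_on_const smooth_on_add)


text \<open>For a linear inner map the derivative in direction v is again a map of the form g(L z),
  with g the derivative of f in the fixed direction L v. The induction therefore closes without a
  general chain rule; projections are the intended L.\<close>

lemma smooth_on_comp_linear:
  assumes "open T" "bounded_linear L" "smooth_on S f" "L ` T \<subseteq> S"
  shows "smooth_on T (\<lambda>z. f (L z))"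
proof -
  have "ck_on k T (\<lambda>z. f (L z))" if "ck_on k S f" for k and f :: "'b \<Rightarrow> 'c"
    using that
  proof (induction k arbitrary: f)
    case 0
    then show ?case
      using continuous_on_compose2[of S f T L] assms(2,4) linear_continuous_on by auto
  next
    case (Suc k)
    have D: "((\<lambda>z. f (L z)) has_derivative (\<lambda>v. frechet_derivative f (at (L z)) (L v))) (at z)"
      if "z \<in> T" for z
      using Suc.prems that assms(4)
      by (auto intro!: has_derivative_compose[of L L, OF bounded_linear.has_derivative[OF assms(2)]]
            has_frechet_derivative)
    have "ck_on k T (\<lambda>x. frechet_derivative (\<lambda>z. f (L z)) (at x) v)" for v
    proof (rule ck_on_cong[OF assms(1)])
      show "ck_on k T (\<lambda>z. frechet_derivative f (at (L z)) (L v))"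
        using Suc.IH[of "\<lambda>y. frechet_derivative f (at y) (L v)"] Suc.prems by simp
    qed (simp add: frechet_derivative_eqI[OF D])
    then show ?case using D unfolding differentiable_def ck_on.simps by blast
  qed
  then show ?thesis using assms(3) by (simp add: smooth_on_def)
qed


section \<open>Directional derivatives, symmetry of second derivatives and the coordinate
  bracket\<close>

definition dir_deriv :: "('a::euclidean_space \<Rightarrow> 'a) \<Rightarrow> ('a \<Rightarrow> 'b::euclidean_space) \<Rightarrow> 'a \<Rightarrow> 'b" where
  "dir_deriv X f = (\<lambda>z. frechet_derivative f (at z) (X z))"

lemma linear_eq_sum_Basis:
  fixes v :: "'a::euclidean_space"
  assumes "linear L"
  shows "L v = (\<Sum>b\<in>Basis. (v \<bullet> b) *\<^sub>R L b)"
proof -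
  have "L v = L (\<Sum>b\<in>Basis. (v \<bullet> b) *\<^sub>R b)" by (simp add: euclidean_representation)
  also have "\<dots> = (\<Sum>b\<in>Basis. (v \<bullet> b) *\<^sub>R L b)"
    using assms by (simp add: linear_sum linear_cmul)
  finally show ?thesis .
qed

text \<open>\<open>ck_on\<close> controls derivatives in fixed directions only. Expanding X z in the
  basis turns the moving direction into smooth coefficients of such derivatives.\<close>

lemma smooth_on_dir_deriv:
  assumes "open S" "smooth_on S X" "smooth_on S f"
  shows "smooth_on S (dir_deriv X f)"
proof (rule smooth_on_cong[OF _ assms(1)])
  show "smooth_on S (\<lambda>z. \<Sum>b\<in>Basis. (X z \<bullet> b) *\<^sub>R frechet_derivative f (at z) b)"
    by (intro smooth_on_sum smooth_on_scaleR smooth_on_frechet assms finite_Basis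
        smooth_on_bounded_linear[OF assms(2,1)] bounded_linear_inner_left)
  show "(\<Sum>b\<in>Basis. (X z \<bullet> b) *\<^sub>R frechet_derivative f (at z) b) = dir_deriv X f z" if "z \<in> S" for z
    unfolding dir_deriv_def
    by (rule linear_eq_sum_Basis[symmetric])
      (simp add: assms(3) linear_frechet_derivative smooth_on_differentiable[OF _ that])
qed

text \<open>The mixed second difference, divided by t^2, tends to A v. Differentiability at the
  single point x of the derivative along u is enough, since the mean value inequality is applied in
  the direction u only.\<close>

lemma second_difference:
  fixes f :: "'a::euclidean_space \<Rightarrow> 'b::euclidean_space"
  assumes "open S" "x \<in> S" "\<And>y. y \<in> S \<Longrightarrow> (f has_derivative f' y) (at y)"
    and A: "((\<lambda>z. f' z u) has_derivative A) (at x)" and "e > 0"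
  shows "\<exists>d>0. \<forall>t. 0 < t \<and> t < d \<longrightarrow>
    norm (f (x + t *\<^sub>R u + t *\<^sub>R v) - f (x + t *\<^sub>R u) - f (x + t *\<^sub>R v) + f x - t\<^sup>2 *\<^sub>R A v) \<le> e * t\<^sup>2"
proof -
  \<comment> \<open>t N bounds the norm of s u + r v for s, r in [0, t]; the summand 1 keeps N
    positive when u = v = 0. Below, e' is chosen so that two remainders of size e' t N, multiplied
    by t, add up to e t^2.\<close>
  define N where "N = norm u + norm v + 1"
  have N: "N > 0" by (simp add: N_def add_nonneg_pos)
  define e' where "e' = e / (2 * N)"
  have e': "e' > 0" using N assms(5) by (simp add: e'_def)
  from A obtain d1 where d1: "d1 > 0"
    "\<And>y. norm (y - x) < d1 \<Longrightarrow> norm (f' y u - f' x u - A (y - x)) \<le> e' * norm (y - x)"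
    using e' unfolding has_derivative_at_alt by blast
  obtain d2 where d2: "d2 > 0" "ball x d2 \<subseteq> S" using assms(1,2) openE by blast
  define d where "d = min d1 d2 / N"
  have "d > 0" using d1 d2 N by (simp add: d_def)
  interpret A: bounded_linear A using A has_derivative_bounded_linear by blast
  show ?thesis
  proof (intro exI[of _ d] conjI allI impI)
    fix t assume t: "0 < t \<and> t < d"
    have tN: "t * N < d1" "t * N < d2" using t N by (auto simp: d_def field_simps)
    have near: "norm (s *\<^sub>R u + r *\<^sub>R v) \<le> t * N" if "0 \<le> s" "s \<le> t" "0 \<le> r" "r \<le> t" for s r
    proof -
      have "norm (s *\<^sub>R u + r *\<^sub>R v) \<le> s * norm u + r * norm v"
        using norm_triangle_ineq[of "s *\<^sub>R u" "r *\<^sub>R v"] that by simp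
      also have "\<dots> \<le> t * norm u + t * norm v"
        using that by (intro add_mono mult_right_mono) auto
      finally show ?thesis using t by (simp add: N_def algebra_simps)
    qed
    \<comment> \<open>g t - g 0 is the second difference minus t^2 A v: the linear term is
      subtracted beforehand, so that the mean value inequality estimates the error itself.\<close>
    define g where "g = (\<lambda>s. f (x + s *\<^sub>R u + t *\<^sub>R v) - f (x + s *\<^sub>R u) - (s * t) *\<^sub>R A v)"
    define g' where "g' = (\<lambda>s r. f' (x + s *\<^sub>R u + t *\<^sub>R v) (r *\<^sub>R u) - f' (x + s *\<^sub>R u) (r *\<^sub>R u) - (r * t) *\<^sub>R A v)"
    have inS: "x + s *\<^sub>R u + t *\<^sub>R v \<in> S" "x + s *\<^sub>R u \<in> S" if "0 \<le> s" "s \<le> t" for s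
      proof -
      have "x + w \<in> S" if "norm w \<le> t * N" for w
        using that tN(2) by (auto intro!: subsetD[OF d2(2)] simp: dist_norm)
      then show "x + s *\<^sub>R u + t *\<^sub>R v \<in> S" "x + s *\<^sub>R u \<in> S"
        using near[of s t] near[of s 0] that t by (simp_all add: add.assoc)
    qed
    have D: "(g has_derivative g' s) (at s)" if "0 \<le> s" "s \<le> t" for s
      unfolding g_def g'_def
      by (intro has_derivative_diff has_derivative_compose[of _ _ _ _ f, OF _ assms(3)] inS that)
        (auto intro!: derivative_eq_intros)
    have "\<exists>s\<in>{0<..<t}. norm (g t - g 0) \<le> norm (g' s (t - 0))"
      using t D by (intro mvt_general continuous_at_imp_continuous_on ballI)
        (auto intro: has_derivative_continuous)
    then obtain s where s: "0 < s" "s < t" and le: "norm (g t - g 0) \<le> norm (g' s t)" by auto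
    have lin: "f' y (t *\<^sub>R u) = t *\<^sub>R f' y u" if "y \<in> S" for y
      using assms(3)[OF that] by (simp add: has_derivative_def linear_simps)
    let ?a = "s *\<^sub>R u + t *\<^sub>R v" and ?b = "s *\<^sub>R u"
    have na: "norm ?a \<le> t * N" and nb: "norm ?b \<le> t * N"
      using near[of s t] near[of s 0] s t by auto
    \<comment> \<open>Since ?a - ?b = t v, linearity of A absorbs the term t^2 A v and leaves two
      first-order remainders of the derivative along u at x.\<close>
    have "g' s t = t *\<^sub>R ((f' (x + ?a) u - f' x u - A ?a) - (f' (x + ?b) u - f' x u - A ?b))"
      using inS[of s] s lin by (simp add: g'_def A.add algebra_simps A.scaleR)
    also have "norm \<dots> \<le> t * (norm (f' (x + ?a) u - f' x u - A ?a) + norm (f' (x + ?b) u - f' x u - A ?b))"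
      unfolding norm_scaleR using t by (intro mult_mono norm_triangle_ineq4) auto
    also have "\<dots> \<le> t * (e' * (t * N) + e' * (t * N))"
    proof -
      have "norm (f' (x + w) u - f' x u - A w) \<le> e' * (t * N)" if "norm w \<le> t * N" for w
      proof -
        have "norm (f' (x + w) u - f' x u - A w) \<le> e' * norm w"
          using d1(2)[of "x + w"] that tN by simp
        also have "\<dots> \<le> e' * (t * N)" using that e' by (intro mult_left_mono) auto
        finally show ?thesis .
      qed
      then show ?thesis using t na nb by (intro mult_left_mono add_mono) auto
    qed
    also have "\<dots> = e * t\<^sup>2" using N by (simp add: e'_def power2_eq_square)
    finally have "norm (g' s t) \<le> e * t\<^sup>2" .
    moreover have "g t - g 0 = f (x + t *\<^sub>R u + t *\<^sub>R v) - f (x + t *\<^sub>R u) - f (x + t *\<^sub>R v) + f x - t\<^sup>2 *\<^sub>R A v"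
      by (simp add: g_def power2_eq_square)
    ultimately show "norm (f (x + t *\<^sub>R u + t *\<^sub>R v) - f (x + t *\<^sub>R u) - f (x + t *\<^sub>R v) + f x - t\<^sup>2 *\<^sub>R A v) \<le> e * t\<^sup>2"
      using le by simp
  qed (use \<open>d > 0\<close> in auto)
qed

text \<open>Swapping u and v leaves the second difference unchanged, while
  \<open>second_difference\<close> approximates it by t^2 A v and by t^2 B u.\<close>

lemma second_derivative_symmetric:
  fixes f :: "'a::euclidean_space \<Rightarrow> 'b::euclidean_space"
  assumes S: "open S" "x \<in> S" "\<And>y. y \<in> S \<Longrightarrow> (f has_derivative f' y) (at y)"
    and A: "((\<lambda>z. f' z u) has_derivative A) (at x)"
    and B: "((\<lambda>z. f' z v) has_derivative B) (at x)"
  shows "A v = B u"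
proof (rule ccontr)
  assume ne: "A v \<noteq> B u"
  \<comment> \<open>Two errors of e t^2 will bound the norm of A v - B u by 2 e, whereas it equals 3
    e.\<close>
  define e where "e = norm (A v - B u) / 3"
  have e: "e > 0" using ne by (simp add: e_def)
  from second_difference[OF S A e, of v] obtain d1 where d1: "d1 > 0" "\<And>t. 0 < t \<Longrightarrow> t < d1 \<Longrightarrow>
    norm (f (x + t *\<^sub>R u + t *\<^sub>R v) - f (x + t *\<^sub>R u) - f (x + t *\<^sub>R v) + f x - t\<^sup>2 *\<^sub>R A v) \<le> e * t\<^sup>2" by blast
  from second_difference[OF S B e, of u] obtain d2 where d2: "d2 > 0" "\<And>t. 0 < t \<Longrightarrow> t < d2 \<Longrightarrow>
    norm (f (x + t *\<^sub>R v + t *\<^sub>R u) - f (x + t *\<^sub>R v) - f (x + t *\<^sub>R u) + f x - t\<^sup>2 *\<^sub>R B u) \<le> e * t\<^sup>2" by blast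
  define t where "t = min d1 d2 / 2"
  have t: "0 < t" "t < d1" "t < d2" using d1 d2 by (auto simp: t_def)
  let ?D = "f (x + t *\<^sub>R u + t *\<^sub>R v) - f (x + t *\<^sub>R u) - f (x + t *\<^sub>R v) + f x"
  have "norm (?D - t\<^sup>2 *\<^sub>R B u) \<le> e * t\<^sup>2" 
    using d2(2)[OF t(1,3)] by (simp add: algebra_simps)
  then have "norm ((?D - t\<^sup>2 *\<^sub>R B u) - (?D - t\<^sup>2 *\<^sub>R A v)) \<le> e * t\<^sup>2 + e * t\<^sup>2"
    using d1(2)[OF t(1,2)] norm_triangle_le_diff add_mono by blast
  moreover have "(?D - t\<^sup>2 *\<^sub>R B u) - (?D - t\<^sup>2 *\<^sub>R A v) = t\<^sup>2 *\<^sub>R (A v - B u)"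
    by (simp add: algebra_simps)
  ultimately have "t\<^sup>2 * norm (A v - B u) \<le> t\<^sup>2 * (2 * e)"
    by (metis (no_types, opaque_lifting) abs_of_nonneg distrib_left mult.commute mult_2 norm_scaleR zero_le_power2)
  then have "norm (A v - B u) \<le> 2 * e" using t by simp
  then show False using e by (simp add: e_def)
qed


text \<open>Both the derivative of f and its argument Y move with the point; in a basis expansion
  the product rule for scalar coefficients handles them together.\<close>

lemma has_derivative_dir_deriv:
  assumes S: "open S" "z \<in> S" and f: "smooth_on S f" and Y: "Y differentiable (at z)"
  shows "(dir_deriv Y f has_derivative (\<lambda>v. frechet_derivative (\<lambda>y. frechet_derivative f (at y) (Y z)) (at z) v
            + frechet_derivative f (at z) (frechet_derivative Y (at z) v))) (at z)"
proof -
  have lin: "linear (frechet_derivative f (at y))" if "y \<in> S" for y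
    using f that by (simp add: linear_frechet_derivative smooth_on_differentiable)
  define H where "H b = frechet_derivative (\<lambda>y. frechet_derivative f (at y) b) (at z)" for b
  have H: "((\<lambda>y. frechet_derivative f (at y) b) has_derivative H b) (at z)" for b
    unfolding H_def by (intro has_frechet_derivative smooth_on_differentiable[OF smooth_on_frechet[OF f] S(2)])
  have "((\<lambda>y. \<Sum>b\<in>Basis. (w \<bullet> b) *\<^sub>R frechet_derivative f (at y) b) has_derivative
      (\<lambda>v. \<Sum>b\<in>Basis. (w \<bullet> b) *\<^sub>R H b v)) (at z)" for w
    by (intro has_derivative_sum has_derivative_scaleR_right H)
  then have "((\<lambda>y. frechet_derivative f (at y) w) has_derivative
      (\<lambda>v. \<Sum>b\<in>Basis. (w \<bullet> b) *\<^sub>R H b v)) (at z)" for w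
    by (rule has_derivative_transform_within_open[OF _ S]) (simp add: linear_eq_sum_Basis[OF lin, symmetric])
  \<comment> \<open>Linearity of the second derivative in the direction w, by uniqueness: both sides
    are derivatives of the same map.\<close>
  then have Hw: "H w v = (\<Sum>b\<in>Basis. (w \<bullet> b) *\<^sub>R H b v)" for w v
    unfolding H_def[of w] by (rule fun_cong[OF frechet_derivative_eqI])
  have "((\<lambda>y. \<Sum>b\<in>Basis. (Y y \<bullet> b) *\<^sub>R frechet_derivative f (at y) b) has_derivative
      (\<lambda>v. \<Sum>b\<in>Basis. (Y z \<bullet> b) *\<^sub>R H b v +
        (frechet_derivative Y (at z) v \<bullet> b) *\<^sub>R frechet_derivative f (at z) b)) (at z)"
    by (intro has_derivative_sum has_derivative_scaleR H has_derivative_inner_left has_frechet_derivative Y)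
  then have "((\<lambda>y. \<Sum>b\<in>Basis. (Y y \<bullet> b) *\<^sub>R frechet_derivative f (at y) b) has_derivative
      (\<lambda>v. H (Y z) v + frechet_derivative f (at z) (frechet_derivative Y (at z) v))) (at z)"
    unfolding sum.distrib Hw[of "Y z", symmetric] linear_eq_sum_Basis[OF lin[OF S(2)], symmetric] .
  then show ?thesis
    unfolding H_def
    by (rule has_derivative_transform_within_open[OF _ S]) (simp add: linear_eq_sum_Basis[OF lin, symmetric] dir_deriv_def)
qed

text \<open>The second-order terms cancel by symmetry. Vector values are allowed so that f can be a
  function, a transition map or another field.\<close>

lemma dir_deriv_commutator:
  assumes S: "open S" "z \<in> S" and f: "smooth_on S f"
    and X: "X differentiable (at z)" and Y: "Y differentiable (at z)"
  shows "frechet_derivative f (at z) (dir_deriv X Y z - dir_deriv Y X z) = dir_deriv X (dir_deriv Y f) z - dir_deriv Y (dir_deriv X f) z"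
proof -
  have "frechet_derivative (\<lambda>y. frechet_derivative f (at y) (Y z)) (at z) (X z) =
      frechet_derivative (\<lambda>y. frechet_derivative f (at y) (X z)) (at z) (Y z)"
    by (rule second_derivative_symmetric[OF S, of f "\<lambda>y. frechet_derivative f (at y)"])
      (auto intro!: has_frechet_derivative smooth_on_differentiable[OF f]
        smooth_on_differentiable[OF smooth_on_frechet[OF f] S(2)])
  moreover have "linear (frechet_derivative f (at z))"
    using f S by (simp add: linear_frechet_derivative smooth_on_differentiable)
  ultimately show ?thesis
    by (simp add: dir_deriv_def[of X "dir_deriv Y f"] dir_deriv_def[of Y "dir_deriv X f"] frechet_derivative_eqI[OF has_derivative_dir_deriv[OF S f]]
        X Y linear_diff) (simp add: dir_deriv_def)
qed

lemma dir_deriv_cong: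
  "\<lbrakk>open S; z \<in> S; \<And>y. y \<in> S \<Longrightarrow> f y = g y\<rbrakk> \<Longrightarrow> dir_deriv X f z = dir_deriv X g z"
  unfolding dir_deriv_def by (metis frechet_derivative_cong_open)

lemma dir_deriv_add:
  "\<lbrakk>f differentiable (at z); g differentiable (at z)\<rbrakk> \<Longrightarrow> dir_deriv X (\<lambda>y. f y + g y) z = dir_deriv X f z + dir_deriv X g z"
  unfolding dir_deriv_def by (simp add: frechet_derivative_eqI[OF has_derivative_add[OF has_frechet_derivative has_frechet_derivative]])

lemma dir_deriv_diff:
  "\<lbrakk>f differentiable (at z); g differentiable (at z)\<rbrakk> \<Longrightarrow> dir_deriv X (\<lambda>y. f y - g y) z = dir_deriv X f z - dir_deriv X g z"
  unfolding dir_deriv_def by (simp add: frechet_derivative_eqI[OF has_derivative_diff[OF has_frechet_derivative has_frechet_derivative]])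

lemma dir_deriv_bounded_linear:
  "\<lbrakk>bounded_linear L; f differentiable (at z)\<rbrakk> \<Longrightarrow> dir_deriv X (\<lambda>y. L (f y)) z = L (dir_deriv X f z)"
  unfolding dir_deriv_def by (simp add: frechet_derivative_eqI[OF bounded_linear.has_derivative[OF _ has_frechet_derivative]])

lemma dir_deriv_field_arith:
  "f differentiable (at z) \<Longrightarrow> dir_deriv (\<lambda>y. X y + Y y) f z = dir_deriv X f z + dir_deriv Y f z"
  "f differentiable (at z) \<Longrightarrow> dir_deriv (\<lambda>y. X y - Y y) f z = dir_deriv X f z - dir_deriv Y f z"
  "f differentiable (at z) \<Longrightarrow> dir_deriv (\<lambda>y. - X y) f z = - dir_deriv X f z"
  unfolding dir_deriv_def by (simp_all add: linear_frechet_derivative linear_add linear_diff linear_neg)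

definition coord_bracket :: "('a::euclidean_space \<Rightarrow> 'a) \<Rightarrow> ('a \<Rightarrow> 'a) \<Rightarrow> 'a \<Rightarrow> 'a" where
  "coord_bracket X Y = (\<lambda>z. dir_deriv X Y z - dir_deriv Y X z)"

lemma smooth_on_coord_bracket: "\<lbrakk>open S; smooth_on S X; smooth_on S Y\<rbrakk> \<Longrightarrow> smooth_on S (coord_bracket X Y)"
  unfolding coord_bracket_def by (intro smooth_on_diff smooth_on_dir_deriv)

text \<open>Differentiating U along [V, W] is expanded by the commutator formula with f = U; the
  second-order terms of the cyclic sum then cancel in pairs.\<close>

lemma coord_bracket_jacobi:
  assumes S: "open S" "z \<in> S" and sm: "smooth_on S X" "smooth_on S Y" "smooth_on S Z"
  shows "coord_bracket X (coord_bracket Y Z) z + coord_bracket Y (coord_bracket Z X) z + coord_bracket Z (coord_bracket X Y) z = 0"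
proof -
  have D: "f differentiable (at z)" if "smooth_on S f" for f :: "'a \<Rightarrow> 'a"
    using that S(2) by (rule smooth_on_differentiable)
  have "coord_bracket U (coord_bracket V W) z = dir_deriv U (dir_deriv V W) z - dir_deriv U (dir_deriv W V) z - (dir_deriv V (dir_deriv W U) z - dir_deriv W (dir_deriv V U) z)"
    if "smooth_on S U" "smooth_on S V" "smooth_on S W" for U V W
    using dir_deriv_commutator[OF S that(1) D[OF that(2)] D[OF that(3)]] that
    unfolding coord_bracket_def[of U]
    by (simp add: coord_bracket_def dir_deriv_diff D smooth_on_dir_deriv S(1) dir_deriv_def[of "\<lambda>z. dir_deriv V W z - dir_deriv W V z"])
  then show ?thesis using sm by simp
qed

section \<open>Vector fields and functions on an atlas\<close>

locale atlas =
  fixes B :: "('a, 'e::euclidean_space) chart set"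
  assumes atlas: "smooth_atlas B"
begin

section \<open>Charts, transition maps and fields in charts\<close>

lemma chart_inv_snd [simp]: "c \<in> B \<Longrightarrow> p \<in> fst c \<Longrightarrow> chart_inv c (snd c p) = p"
  using atlas by (simp add: smooth_atlas_def chart_inv_def)

lemma chart_inv_image:
  assumes "c \<in> B" "z \<in> snd c ` fst c"
  shows "chart_inv c z \<in> fst c" "snd c (chart_inv c z) = z"
  using assms by auto

lemma open_overlap: "c \<in> B \<Longrightarrow> c' \<in> B \<Longrightarrow> open (snd c ` (fst c \<inter> fst c'))"
  using atlas by (auto simp: smooth_atlas_def)

lemma open_image: "c \<in> B \<Longrightarrow> open (snd c ` fst c)"
  using open_overlap[of c c] by simp

lemma smooth_transition:
  "c \<in> B \<Longrightarrow> c' \<in> B \<Longrightarrow> smooth_on (snd c ` (fst c \<inter> fst c')) (snd c' \<circ> chart_inv c)"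
  using atlas by (auto simp: smooth_atlas_def)

lemma in_carrier: "c \<in> B \<Longrightarrow> p \<in> fst c \<Longrightarrow> p \<in> carrier B"
  by (auto simp: carrier_def)

lemma carrierE:
  assumes "p \<in> carrier B"
  obtains c where "c \<in> B" "p \<in> fst c"
  using assms by (auto simp: carrier_def)

text \<open>Vector values let one chain rule serve functions, coordinate maps and the components of
  a field.\<close>

lemma transition_chain:
  fixes f :: "'a \<Rightarrow> 'b::euclidean_space"
  assumes c: "c \<in> B" "c' \<in> B" "p \<in> fst c" "p \<in> fst c'"
    and f: "(f \<circ> chart_inv c') differentiable (at (snd c' p))"
  shows "frechet_derivative (f \<circ> chart_inv c) (at (snd c p)) v =
    frechet_derivative (f \<circ> chart_inv c') (at (snd c' p))
      (frechet_derivative (snd c' \<circ> chart_inv c) (at (snd c p)) v)"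
proof -
  let ?O = "snd c ` (fst c \<inter> fst c')"
  have O: "open ?O" "snd c p \<in> ?O" using c open_overlap by auto
  have d: "(snd c' \<circ> chart_inv c) differentiable (at (snd c p))"
    using smooth_on_differentiable[OF smooth_transition[OF c(1,2)] O(2)] .
  have "frechet_derivative (f \<circ> chart_inv c) (at (snd c p)) =
      frechet_derivative ((f \<circ> chart_inv c') \<circ> (snd c' \<circ> chart_inv c)) (at (snd c p))"
    using c by (intro frechet_derivative_cong_open[OF O]) auto
  also have "\<dots> = frechet_derivative (f \<circ> chart_inv c') (at (snd c' p)) \<circ>
      frechet_derivative (snd c' \<circ> chart_inv c) (at (snd c p))"
    using frechet_derivative_compose[OF d, of "f \<circ> chart_inv c'"] f c by simp
  finally show ?thesis by simp
qed

lemma field_transition: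
  "\<lbrakk>X \<in> vector_fields B; c \<in> B; c' \<in> B; p \<in> fst c; p \<in> fst c'\<rbrakk> \<Longrightarrow>
    X p c' = frechet_derivative (snd c' \<circ> chart_inv c) (at (snd c p)) (X p c)"
  unfolding vector_fields_def tangent_space_def by blast

lemma field_outside: "X \<in> vector_fields B \<Longrightarrow> \<not> (c \<in> B \<and> p \<in> fst c) \<Longrightarrow> X p c = 0"
  unfolding vector_fields_def tangent_space_def by blast

lemma smooth_rep: "X \<in> vector_fields B \<Longrightarrow> c \<in> B \<Longrightarrow> smooth_on (snd c ` fst c) (rep c X)"
  by (simp add: vector_fields_def)

lemma differentiable_rep:
  "\<lbrakk>X \<in> vector_fields B; c \<in> B; z \<in> snd c ` fst c\<rbrakk> \<Longrightarrow> rep c X differentiable (at z)"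
  using smooth_on_differentiable smooth_rep by blast

lemma rep_snd: "c \<in> B \<Longrightarrow> p \<in> fst c \<Longrightarrow> rep c X (snd c p) = X p c"
  by (simp add: rep_def)

lemma vector_fieldI:
  assumes "\<And>p c c'. \<lbrakk>c \<in> B; c' \<in> B; p \<in> fst c; p \<in> fst c'\<rbrakk> \<Longrightarrow>
      X p c' = frechet_derivative (snd c' \<circ> chart_inv c) (at (snd c p)) (X p c)"
    and "\<And>p c. \<not> (c \<in> B \<and> p \<in> fst c) \<Longrightarrow> X p c = 0"
    and "\<And>c. c \<in> B \<Longrightarrow> smooth_on (snd c ` fst c) (rep c X)"
  shows "X \<in> vector_fields B"
  using assms unfolding vector_fields_def tangent_space_def by blast

lemma field_eqI:
  assumes "X \<in> vector_fields B" "Y \<in> vector_fields B"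
    and "\<And>p c. c \<in> B \<Longrightarrow> p \<in> fst c \<Longrightarrow> X p c = Y p c"
  shows "X = Y"
proof (intro ext)
  fix p c show "X p c = Y p c"
    using assms(3) field_outside[OF assms(1)] field_outside[OF assms(2)]
    by (cases "c \<in> B \<and> p \<in> fst c") auto
qed

lemma field_eq_carrierI:
  assumes "X \<in> vector_fields B" "Y \<in> vector_fields B" "\<And>p. p \<in> carrier B \<Longrightarrow> X p = Y p"
  shows "X = Y"
  using assms by (intro field_eqI) (auto simp: in_carrier)

lemma linear_transition:
  "\<lbrakk>c \<in> B; c' \<in> B; p \<in> fst c; p \<in> fst c'\<rbrakk> \<Longrightarrow>
    linear (frechet_derivative (snd c' \<circ> chart_inv c) (at (snd c p)))"
  by (intro linear_frechet_derivative smooth_on_differentiable[OF smooth_transition]) auto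

lemma field_zero: "0 \<in> vector_fields B"
proof (rule vector_fieldI)
  show "smooth_on (snd c ` fst c) (rep c 0)" for c
    by (simp add: rep_def smooth_on_const)
qed (simp_all add: linear_transition linear_0)

lemma field_add:
  assumes "X \<in> vector_fields B" "Y \<in> vector_fields B"
  shows "X + Y \<in> vector_fields B"
proof (rule vector_fieldI)
  show "smooth_on (snd c ` fst c) (rep c (X + Y))" if "c \<in> B" for c
    using smooth_on_add[OF smooth_rep[OF assms(1) that] smooth_rep[OF assms(2) that] open_image[OF that]]
    by (simp add: rep_def)
  show "(X + Y) p c' = frechet_derivative (snd c' \<circ> chart_inv c) (at (snd c p)) ((X + Y) p c)"
    if "c \<in> B" "c' \<in> B" "p \<in> fst c" "p \<in> fst c'" for p c c'
    using that field_transition[OF assms(1) that] field_transition[OF assms(2) that]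
    by (simp add: linear_transition linear_add)
qed (simp add: field_outside assms)

lemma field_diff:
  assumes "X \<in> vector_fields B" "Y \<in> vector_fields B"
  shows "X - Y \<in> vector_fields B"
proof (rule vector_fieldI)
  show "smooth_on (snd c ` fst c) (rep c (X - Y))" if "c \<in> B" for c
    using smooth_on_diff[OF smooth_rep[OF assms(1) that] smooth_rep[OF assms(2) that] open_image[OF that]]
    by (simp add: rep_def)
  show "(X - Y) p c' = frechet_derivative (snd c' \<circ> chart_inv c) (at (snd c p)) ((X - Y) p c)"
    if "c \<in> B" "c' \<in> B" "p \<in> fst c" "p \<in> fst c'" for p c c'
    using that field_transition[OF assms(1) that] field_transition[OF assms(2) that]
    by (simp add: linear_transition linear_diff)
qed (simp add: field_outside assms)

lemma field_uminus: "X \<in> vector_fields B \<Longrightarrow> - X \<in> vector_fields B"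
  using field_diff[OF field_zero, of X] by simp

lemma field_scale:
  assumes "X \<in> vector_fields B"
  shows "fmult (\<lambda>_. r) X \<in> vector_fields B"
proof (rule vector_fieldI)
  show "smooth_on (snd c ` fst c) (rep c (fmult (\<lambda>_. r) X))" if "c \<in> B" for c
    using smooth_on_bounded_linear[OF smooth_rep[OF assms(1) that] open_image[OF that] bounded_linear_scaleR_right]
    by (simp add: rep_def fmult_def)
  show "fmult (\<lambda>_. r) X p c' = frechet_derivative (snd c' \<circ> chart_inv c) (at (snd c p)) (fmult (\<lambda>_. r) X p c)"
    if "c \<in> B" "c' \<in> B" "p \<in> fst c" "p \<in> fst c'" for p c c'
    using that field_transition[OF assms(1) that]
    by (simp add: linear_transition linear_cmul fmult_def)
qed (simp add: field_outside assms fmult_def)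

section \<open>The Lie bracket on an atlas\<close>

lemma rep_lie_bracket:
  assumes "c \<in> B" "z \<in> snd c ` fst c"
  shows "rep c (lie_bracket B X Y) z = coord_bracket (rep c X) (rep c Y) z"
  using assms by (auto simp: rep_def lie_bracket_def coord_bracket_def dir_deriv_def)

lemma lie_bracket_apply:
  assumes "c \<in> B" "p \<in> fst c"
  shows "lie_bracket B X Y p c = coord_bracket (rep c X) (rep c Y) (snd c p)"
  using assms rep_lie_bracket[of c "snd c p"] rep_snd[OF assms] by auto

text \<open>In the coordinates of \<open>c'\<close> a field is the Lie derivative of the transition map \<open>\<tau>\<close> along its
  representative in \<open>c\<close>, so naturality of the bracket is the commutator formula applied to \<open>\<tau>\<close>.\<close>

lemma field_lie_bracket:
  assumes X: "X \<in> vector_fields B" and Y: "Y \<in> vector_fields B"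
  shows "lie_bracket B X Y \<in> vector_fields B"
proof (rule vector_fieldI)
  show "smooth_on (snd c ` fst c) (rep c (lie_bracket B X Y))" if "c \<in> B" for c
  proof (rule smooth_on_cong)
    show "smooth_on (snd c ` fst c) (coord_bracket (rep c X) (rep c Y))"
      using that by (intro smooth_on_coord_bracket open_image smooth_rep X Y)
  qed (use that rep_lie_bracket open_image in auto)
  fix p c c' assume c: "c \<in> B" "c' \<in> B" "p \<in> fst c" "p \<in> fst c'"
  let ?O = "snd c ` (fst c \<inter> fst c')" and ?\<tau> = "snd c' \<circ> chart_inv c"
  have O: "open ?O" "snd c p \<in> ?O" using c open_overlap by auto
  have \<tau>: "smooth_on ?O ?\<tau>" by (rule smooth_transition[OF c(1,2)])
  have rp: "rep c U differentiable (at (snd c p))" "rep c' U differentiable (at (snd c' p))"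
    if "U \<in> vector_fields B" for U
    using that c by (auto intro!: differentiable_rep)
  have step: "frechet_derivative (rep c' U) (at (snd c' p)) (V p c') = dir_deriv (rep c V) (dir_deriv (rep c U) ?\<tau>) (snd c p)"
    if U: "U \<in> vector_fields B" and V: "V \<in> vector_fields B" for U V
  proof -
    have "dir_deriv (rep c V) (dir_deriv (rep c U) ?\<tau>) (snd c p) =
        frechet_derivative ((\<lambda>q. U q c') \<circ> chart_inv c) (at (snd c p)) (V p c)"
      unfolding dir_deriv_def[of "rep c V"] rep_snd[OF c(1,3)]
      using field_transition[OF U c(1,2)] c(1)
      by (intro fun_cong[OF frechet_derivative_cong_open[OF O]]) (auto simp: dir_deriv_def rep_def)
    also have "\<dots> = frechet_derivative (rep c' U) (at (snd c' p)) (V p c')"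
      using transition_chain[OF c, of "\<lambda>q. U q c'"] rp(2)[OF U] field_transition[OF V c]
      by (simp add: rep_def comp_def)
    finally show ?thesis by simp
  qed
  have "lie_bracket B X Y p c' = frechet_derivative ?\<tau> (at (snd c p))
      (dir_deriv (rep c X) (rep c Y) (snd c p) - dir_deriv (rep c Y) (rep c X) (snd c p))"
    using c step[OF X Y] step[OF Y X]
    by (simp add: lie_bracket_def dir_deriv_commutator[OF O \<tau> rp(1)[OF X] rp(1)[OF Y]])
  then show "lie_bracket B X Y p c' = frechet_derivative ?\<tau> (at (snd c p)) (lie_bracket B X Y p c)"
    using c by (simp add: lie_bracket_apply coord_bracket_def)
qed (auto simp: lie_bracket_def)

lemma rep_plus: "rep c (X + Y) = (\<lambda>z. rep c X z + rep c Y z)"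
  by (simp add: rep_def)

lemma lie_bracket_skew: "lie_bracket B X Y = - lie_bracket B Y X"
  by (auto simp: lie_bracket_def fun_eq_iff)

lemma lie_bracket_add_right:
  assumes "X \<in> vector_fields B" "Y \<in> vector_fields B" "Z \<in> vector_fields B"
  shows "lie_bracket B X (Y + Z) = lie_bracket B X Y + lie_bracket B X Z"
proof (rule field_eqI)
  fix p c assume c: "c \<in> B" "p \<in> fst c"
  have D: "rep c U differentiable (at (snd c p))" if "U \<in> vector_fields B" for U
    using differentiable_rep[OF that] c by auto
  show "lie_bracket B X (Y + Z) p c = (lie_bracket B X Y + lie_bracket B X Z) p c"
    using c assms D by (simp add: lie_bracket_apply coord_bracket_def rep_plus dir_deriv_add dir_deriv_field_arith)
qed (intro field_lie_bracket field_add assms)+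

lemma lie_bracket_diff_right:
  assumes "X \<in> vector_fields B" "Y \<in> vector_fields B" "Z \<in> vector_fields B"
  shows "lie_bracket B X (Y - Z) = lie_bracket B X Y - lie_bracket B X Z"
  using lie_bracket_add_right[OF assms(1) field_diff[OF assms(2,3)] assms(3)] by (simp add: algebra_simps)

lemma lie_bracket_diff_left:
  assumes "X \<in> vector_fields B" "Y \<in> vector_fields B" "Z \<in> vector_fields B"
  shows "lie_bracket B (X - Y) Z = lie_bracket B X Z - lie_bracket B Y Z"
  using lie_bracket_diff_right[OF assms(3,1,2)] lie_bracket_skew[of _ Z]
  by (metis minus_diff_minus)

lemma jacobi:
  assumes "X \<in> vector_fields B" "Y \<in> vector_fields B" "Z \<in> vector_fields B"
  shows "lie_bracket B X (lie_bracket B Y Z) - lie_bracket B Y (lie_bracket B X Z)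
    = lie_bracket B (lie_bracket B X Y) Z"
proof (rule field_eqI)
  fix p c assume c: "c \<in> B" "p \<in> fst c"
  let ?S = "snd c ` fst c"
  have S: "open ?S" "snd c p \<in> ?S" using c open_image by auto
  \<comment> \<open>The outer bracket differentiates the inner one, so the coordinate formula is
    needed on the whole chart image and not just at p.\<close>
  have twice: "lie_bracket B U (lie_bracket B V W) p c = coord_bracket (rep c U) (coord_bracket (rep c V) (rep c W)) (snd c p)" for U V W
  proof -
    have "rep c (lie_bracket B V W) (snd c p) = coord_bracket (rep c V) (rep c W) (snd c p)"
      using c by (simp add: rep_lie_bracket)
    moreover have "dir_deriv (rep c U) (rep c (lie_bracket B V W)) (snd c p) = dir_deriv (rep c U) (coord_bracket (rep c V) (rep c W)) (snd c p)"
      using c by (intro dir_deriv_cong[OF S]) (simp add: rep_lie_bracket)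
    ultimately show ?thesis using c by (simp add: lie_bracket_apply coord_bracket_def[of "rep c U"]) (simp add: dir_deriv_def)
  qed
  have "lie_bracket B X (lie_bracket B Y Z) p c + lie_bracket B Y (lie_bracket B Z X) p c
      + lie_bracket B Z (lie_bracket B X Y) p c = 0"
    unfolding twice by (intro coord_bracket_jacobi[OF S] smooth_rep assms c)
  moreover have "lie_bracket B Y (lie_bracket B Z X) p c = - lie_bracket B Y (lie_bracket B X Z) p c"
  proof -
    have "lie_bracket B Y (lie_bracket B Z X) = lie_bracket B Y (0 - lie_bracket B X Z)"
      using lie_bracket_skew[of Z X] by simp
    also have "\<dots> = lie_bracket B Y 0 - lie_bracket B Y (lie_bracket B X Z)"
      by (intro lie_bracket_diff_right field_zero field_lie_bracket assms)
    also have "lie_bracket B Y 0 = 0"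
      using lie_bracket_diff_right[OF assms(2) assms(2) assms(2)] by simp
    finally show ?thesis by simp
  qed
  moreover have "lie_bracket B (lie_bracket B X Y) Z p c = - lie_bracket B Z (lie_bracket B X Y) p c"
    by (subst lie_bracket_skew) simp
  ultimately show "(lie_bracket B X (lie_bracket B Y Z) - lie_bracket B Y (lie_bracket B X Z)) p c
    = lie_bracket B (lie_bracket B X Y) Z p c" by (simp add: algebra_simps add_eq_0_iff)
qed (intro field_lie_bracket field_diff assms)+

section \<open>Smooth functions and derivations\<close>

lemma smooth_funD: "smooth_fun B f \<Longrightarrow> c \<in> B \<Longrightarrow> smooth_on (snd c ` fst c) (f \<circ> chart_inv c)"
  by (simp add: smooth_fun_def ck_fun_def smooth_on_def)

lemma smooth_funI: "(\<And>c. c \<in> B \<Longrightarrow> smooth_on (snd c ` fst c) (f \<circ> chart_inv c)) \<Longrightarrow> smooth_fun B f"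
  by (simp add: smooth_fun_def ck_fun_def smooth_on_def)

lemma smooth_fun_differentiable:
  "\<lbrakk>smooth_fun B f; c \<in> B; z \<in> snd c ` fst c\<rbrakk> \<Longrightarrow> (f \<circ> chart_inv c) differentiable (at z)"
  using smooth_funD smooth_on_differentiable by blast

lemma smooth_fun_add:
  assumes "smooth_fun B f" "smooth_fun B g"
  shows "smooth_fun B (f + g)"
proof (rule smooth_funI)
  fix c assume c: "c \<in> B"
  show "smooth_on (snd c ` fst c) ((f + g) \<circ> chart_inv c)"
    using smooth_on_add[OF smooth_funD[OF assms(1) c] smooth_funD[OF assms(2) c] open_image[OF c]]
    by (simp add: comp_def)
qed

lemma smooth_fun_diff:
  assumes "smooth_fun B f" "smooth_fun B g"
  shows "smooth_fun B (f - g)"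
proof (rule smooth_funI)
  fix c assume c: "c \<in> B"
  show "smooth_on (snd c ` fst c) ((f - g) \<circ> chart_inv c)"
    using smooth_on_diff[OF smooth_funD[OF assms(1) c] smooth_funD[OF assms(2) c] open_image[OF c]]
    by (simp add: comp_def)
qed

lemma smooth_fun_const: "smooth_fun B (\<lambda>_. r)"
  by (intro smooth_funI) (auto simp: comp_def smooth_on_const)

text \<open>Later identities between functions hold on the carrier only; this allows them to be
  rewritten under a derivative.\<close>

lemma deriv_along_cong:
  assumes "\<And>q. q \<in> carrier B \<Longrightarrow> f q = g q" "p \<in> carrier B"
  shows "deriv_along B X f p = deriv_along B X g p"
proof -
  define c where "c = (SOME c. c \<in> B \<and> p \<in> fst c)"
  have "\<exists>c. c \<in> B \<and> p \<in> fst c" using assms(2) by (auto simp: carrier_def)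
  then have c: "c \<in> B \<and> p \<in> fst c" unfolding c_def by (rule someI_ex)
  have "frechet_derivative (f \<circ> chart_inv c) (at (snd c p)) = frechet_derivative (g \<circ> chart_inv c) (at (snd c p))"
  proof (rule frechet_derivative_cong_open)
    show "open (snd c ` fst c)" "snd c p \<in> snd c ` fst c" using c open_image by auto
    show "(f \<circ> chart_inv c) z = (g \<circ> chart_inv c) z" if "z \<in> snd c ` fst c" for z
      using assms(1)[OF in_carrier[OF _ chart_inv_image(1)[OF _ that]]] c by simp
  qed
  then show ?thesis unfolding deriv_along_def c_def[symmetric] by simp
qed

text \<open>Frees \<open>deriv_along\<close> from its chosen chart: the chain rule across the
  transition map matches the transformation law of X.\<close>

lemma deriv_along_chart:
  assumes "smooth_fun B f" "X \<in> vector_fields B" "c \<in> B" "p \<in> fst c"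
  shows "deriv_along B X f p = dir_deriv (rep c X) (f \<circ> chart_inv c) (snd c p)"
proof -
  define d where "d = (SOME c. c \<in> B \<and> p \<in> fst c)"
  have "\<exists>c. c \<in> B \<and> p \<in> fst c" using assms(3,4) by blast
  then have d: "d \<in> B \<and> p \<in> fst d" unfolding d_def by (rule someI_ex)
  have "deriv_along B X f p = frechet_derivative (f \<circ> chart_inv d) (at (snd d p)) (X p d)"
    unfolding deriv_along_def d_def[symmetric] by simp
  also have "\<dots> = frechet_derivative (f \<circ> chart_inv c) (at (snd c p)) (X p c)"
  proof -
    have "(f \<circ> chart_inv d) differentiable (at (snd d p))"
      using smooth_fun_differentiable[OF assms(1)] d by blast
    then show ?thesis
      using transition_chain[of c d p f "X p c"] field_transition[of X c d p] assms(2-4) d by metis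
  qed
  finally show ?thesis using rep_snd[OF assms(3,4)] by (simp add: dir_deriv_def)
qed

lemma deriv_along_comp:
  assumes "smooth_fun B f" "X \<in> vector_fields B" "c \<in> B" "z \<in> snd c ` fst c"
  shows "(deriv_along B X f \<circ> chart_inv c) z = dir_deriv (rep c X) (f \<circ> chart_inv c) z"
proof -
  from assms(4) obtain p where p: "p \<in> fst c" "z = snd c p" by blast
  then show ?thesis using deriv_along_chart[OF assms(1-3) p(1)] assms(3) by simp
qed

lemma smooth_deriv_along:
  assumes "smooth_fun B f" "X \<in> vector_fields B"
  shows "smooth_fun B (deriv_along B X f)"
proof (rule smooth_funI)
  fix c assume c: "c \<in> B"
  show "smooth_on (snd c ` fst c) (deriv_along B X f \<circ> chart_inv c)"
  proof (rule smooth_on_cong)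
    show "smooth_on (snd c ` fst c) (dir_deriv (rep c X) (f \<circ> chart_inv c))"
      using c by (intro smooth_on_dir_deriv open_image smooth_rep smooth_funD assms)
  qed (use deriv_along_comp[OF assms c] open_image c in auto)
qed

lemma deriv_along_add:
  assumes "smooth_fun B f" "smooth_fun B g" "X \<in> vector_fields B" "p \<in> carrier B"
  shows "deriv_along B X (f + g) p = deriv_along B X f p + deriv_along B X g p"
proof -
  obtain c where c: "c \<in> B" "p \<in> fst c" using assms(4) by (rule carrierE)
  have D: "(h \<circ> chart_inv c) differentiable (at (snd c p))" if "smooth_fun B h" for h
    using smooth_fun_differentiable[OF that c(1)] c by blast
  have "deriv_along B X (f + g) p = dir_deriv (rep c X) (\<lambda>z. (f \<circ> chart_inv c) z + (g \<circ> chart_inv c) z) (snd c p)"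
    using deriv_along_chart[OF smooth_fun_add[OF assms(1,2)] assms(3) c] by (simp add: comp_def)
  then show ?thesis
    by (simp only: dir_deriv_add[OF D[OF assms(1)] D[OF assms(2)]] deriv_along_chart[OF _ assms(3) c] assms)
qed

lemma deriv_along_diff:
  assumes "smooth_fun B f" "smooth_fun B g" "X \<in> vector_fields B" "p \<in> carrier B"
  shows "deriv_along B X (f - g) p = deriv_along B X f p - deriv_along B X g p"
proof -
  obtain c where c: "c \<in> B" "p \<in> fst c" using assms(4) by (rule carrierE)
  have D: "(h \<circ> chart_inv c) differentiable (at (snd c p))" if "smooth_fun B h" for h
    using smooth_fun_differentiable[OF that c(1)] c by blast
  have "deriv_along B X (f - g) p = dir_deriv (rep c X) (\<lambda>z. (f \<circ> chart_inv c) z - (g \<circ> chart_inv c) z) (snd c p)"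
    using deriv_along_chart[OF smooth_fun_diff[OF assms(1,2)] assms(3) c] by (simp add: comp_def)
  then show ?thesis
    by (simp only: dir_deriv_diff[OF D[OF assms(1)] D[OF assms(2)]] deriv_along_chart[OF _ assms(3) c] assms)
qed

lemma deriv_along_field_add:
  assumes "smooth_fun B f" "X \<in> vector_fields B" "Y \<in> vector_fields B" "p \<in> carrier B"
  shows "deriv_along B (X + Y) f p = deriv_along B X f p + deriv_along B Y f p"
proof -
  obtain c where c: "c \<in> B" "p \<in> fst c" using assms(4) by (rule carrierE)
  have "(f \<circ> chart_inv c) differentiable (at (snd c p))"
    using smooth_fun_differentiable[OF assms(1) c(1)] c by blast
  then show ?thesis
    using assms by (simp add: deriv_along_chart[OF _ _ c] field_add rep_plus dir_deriv_field_arith)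
qed

lemma deriv_along_field_diff:
  assumes "smooth_fun B f" "X \<in> vector_fields B" "Y \<in> vector_fields B" "p \<in> carrier B"
  shows "deriv_along B (X - Y) f p = deriv_along B X f p - deriv_along B Y f p"
  using deriv_along_field_add[OF assms(1) field_diff[OF assms(2,3)] assms(3,4)] by simp

lemma deriv_along_field_zero:
  assumes "smooth_fun B f" "p \<in> carrier B"
  shows "deriv_along B 0 f p = 0"
  using deriv_along_field_diff[OF assms(1) field_zero field_zero assms(2)] by simp

lemma deriv_along_const:
  assumes "X \<in> vector_fields B" "p \<in> carrier B"
  shows "deriv_along B X (\<lambda>_. r) p = 0"
proof -
  obtain c where c: "c \<in> B" "p \<in> fst c" using assms(2) by (rule carrierE)
  then show ?thesis
    using assms by (simp add: deriv_along_chart[OF _ _ c] smooth_fun_const dir_deriv_def comp_def)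
qed

lemma deriv_along_lie_bracket:
  assumes f: "smooth_fun B f" and X: "X \<in> vector_fields B" and Y: "Y \<in> vector_fields B" and p: "p \<in> carrier B"
  shows "deriv_along B (lie_bracket B X Y) f p =
    deriv_along B X (deriv_along B Y f) p - deriv_along B Y (deriv_along B X f) p"
proof -
  obtain c where c: "c \<in> B" "p \<in> fst c" using p by (rule carrierE)
  let ?S = "snd c ` fst c"
  have S: "open ?S" "snd c p \<in> ?S" using c open_image by auto
  have twice: "deriv_along B U (deriv_along B V f) p = dir_deriv (rep c U) (dir_deriv (rep c V) (f \<circ> chart_inv c)) (snd c p)"
    if "U \<in> vector_fields B" "V \<in> vector_fields B" for U V
  proof -
    have "deriv_along B U (deriv_along B V f) p = dir_deriv (rep c U) (deriv_along B V f \<circ> chart_inv c) (snd c p)"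
      using that f c by (intro deriv_along_chart smooth_deriv_along)
    also have "\<dots> = dir_deriv (rep c U) (dir_deriv (rep c V) (f \<circ> chart_inv c)) (snd c p)"
      by (rule dir_deriv_cong[OF S deriv_along_comp[OF f that(2) c(1)]])
    finally show ?thesis .
  qed
  have "deriv_along B (lie_bracket B X Y) f p = frechet_derivative (f \<circ> chart_inv c) (at (snd c p))
      (dir_deriv (rep c X) (rep c Y) (snd c p) - dir_deriv (rep c Y) (rep c X) (snd c p))"
    using deriv_along_chart[OF f field_lie_bracket[OF X Y] c] rep_lie_bracket[OF c(1) S(2), of X Y]
    by (simp add: dir_deriv_def[of "rep c (lie_bracket B X Y)"] coord_bracket_def)
  also have "\<dots> = dir_deriv (rep c X) (dir_deriv (rep c Y) (f \<circ> chart_inv c)) (snd c p) - dir_deriv (rep c Y) (dir_deriv (rep c X) (f \<circ> chart_inv c)) (snd c p)"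
    by (intro dir_deriv_commutator[OF S] smooth_funD[OF f] differentiable_rep c X Y S)
  finally show ?thesis using twice X Y by simp
qed

end

section \<open>The slit tangent bundle\<close>

lemma smooth_on_ident: "smooth_on S (\<lambda>x. x)"
proof -
  have "ck_on k S (\<lambda>x. x)" for k
    using smooth_on_const[of S] by (cases k) (auto simp: smooth_on_def)
  then show ?thesis by (simp add: smooth_on_def)
qed

lemma smooth_on_Pair:
  assumes "smooth_on S f" "smooth_on S g" "open S"
  shows "smooth_on S (\<lambda>x. (f x, g x))"
proof -
  have "smooth_on S (\<lambda>x. (f x, 0) + (0, g x))"
    by (intro smooth_on_add smooth_on_bounded_linear[OF assms(1,3), of "\<lambda>y. (y, 0)"]
        smooth_on_bounded_linear[OF assms(2,3), of "\<lambda>y. (0, y)"] assms(3)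
        bounded_linear_Pair bounded_linear_ident bounded_linear_zero)
  then show ?thesis by simp
qed

lemma smooth_on_tangent_map:
  fixes f :: "'a::euclidean_space \<Rightarrow> 'a"
  assumes f: "smooth_on S f" and S: "open S" and T: "open T"
  shows "smooth_on (S \<times> T) (\<lambda>u. (f (fst u), frechet_derivative f (at (fst u)) (snd u)))"
proof (rule smooth_on_Pair)
  have ST: "open (S \<times> T)" using S T by (rule open_Times)
  have fst: "smooth_on (S \<times> T) (\<lambda>u. g (fst u))" if "smooth_on S g" for g :: "'a \<Rightarrow> 'a"
    by (rule smooth_on_comp_linear[OF ST bounded_linear_fst that]) auto
  show "smooth_on (S \<times> T) (\<lambda>u. f (fst u))" by (rule fst[OF f])
  show "smooth_on (S \<times> T) (\<lambda>u. frechet_derivative f (at (fst u)) (snd u))"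
  proof (rule smooth_on_cong[OF _ ST])
    have "smooth_on (S \<times> T) (\<lambda>u. snd u \<bullet> b)" for b :: 'a
      using smooth_on_bounded_linear[OF smooth_on_ident ST, of "\<lambda>u. snd u \<bullet> b"]
      by (simp add: bounded_linear_inner_left_comp bounded_linear_snd)
    then have "smooth_on (S \<times> T) (\<lambda>u. (snd u \<bullet> b) *\<^sub>R frechet_derivative f (at (fst u)) b)" for b
      by (rule smooth_on_scaleR[OF _ fst[OF smooth_on_frechet[OF f]] ST])
    then show "smooth_on (S \<times> T) (\<lambda>u. \<Sum>b\<in>Basis. (snd u \<bullet> b) *\<^sub>R frechet_derivative f (at (fst u)) b)"
      by (rule smooth_on_sum[OF finite_Basis ST])
    show "(\<Sum>b\<in>Basis. (snd u \<bullet> b) *\<^sub>R frechet_derivative f (at (fst u)) b) =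
        frechet_derivative f (at (fst u)) (snd u)" if "u \<in> S \<times> T" for u
      using that by (intro linear_eq_sum_Basis[symmetric] linear_frechet_derivative smooth_on_differentiable[OF f]) auto
  qed
qed (rule open_Times[OF S T])

text \<open>The Jacobian of a tangent map is block triangular with the same block twice on the
  diagonal. This is what makes J independent of the chart.\<close>

lemma tangent_map_derivative:
  fixes f :: "'a::euclidean_space \<Rightarrow> 'a"
  assumes f: "smooth_on S f" and S: "open S" and T: "open T" and u: "u \<in> S \<times> T"
  defines "\<tau> \<equiv> \<lambda>u. (f (fst u), frechet_derivative f (at (fst u)) (snd u))"
  shows "fst (frechet_derivative \<tau> (at u) h) = frechet_derivative f (at (fst u)) (fst h)"
    and "frechet_derivative \<tau> (at u) (0, v) = (0, frechet_derivative f (at (fst u)) v)"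
proof -
  let ?D = "frechet_derivative \<tau> (at u)"
  have D: "(\<tau> has_derivative ?D) (at u)"
    unfolding \<tau>_def
    by (intro has_frechet_derivative smooth_on_differentiable[OF smooth_on_tangent_map[OF f S T] u])
  have f': "(f has_derivative frechet_derivative f (at (fst u))) (at (fst u))"
    using u by (intro has_frechet_derivative smooth_on_differentiable[OF f]) auto
  have "((\<lambda>u. f (fst u)) has_derivative (\<lambda>h. frechet_derivative f (at (fst u)) (fst h))) (at u)"
    by (rule has_derivative_compose[OF has_derivative_fst[OF has_derivative_ident] f'])
  moreover have "((\<lambda>u. f (fst u)) has_derivative (\<lambda>h. fst (?D h))) (at u)"
    using has_derivative_fst[OF D] by (simp add: \<tau>_def)
  ultimately have "(\<lambda>h. fst (?D h)) = (\<lambda>h. frechet_derivative f (at (fst u)) (fst h))"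
    using has_derivative_unique by blast
  then show 1: "fst (?D h) = frechet_derivative f (at (fst u)) (fst h)" for h by (rule fun_cong)
  have lin: "bounded_linear (frechet_derivative f (at (fst u)))" using f' has_derivative_bounded_linear by blast
  have D': "(\<tau> has_derivative ?D) (at (fst u, snd u))" using D by simp
  \<comment> \<open>On a fixed fibre the second component is linear, hence its own derivative; no
    second derivative of f has to be computed.\<close>
  have "((\<lambda>b. \<tau> (fst u, b)) has_derivative (\<lambda>v. ?D (0, v))) (at (snd u))"
    by (rule has_derivative_compose[where g = \<tau> and f = "\<lambda>b. (fst u, b)", OF _ D'])
      (intro has_derivative_Pair has_derivative_const has_derivative_ident)
  then have "((\<lambda>b. snd (\<tau> (fst u, b))) has_derivative (\<lambda>v. snd (?D (0, v)))) (at (snd u))"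
    by (rule has_derivative_snd)
  moreover have "((\<lambda>b. snd (\<tau> (fst u, b))) has_derivative frechet_derivative f (at (fst u))) (at (snd u))"
    using bounded_linear_imp_has_derivative[OF lin] by (simp add: \<tau>_def)
  ultimately have "(\<lambda>v. snd (?D (0, v))) = frechet_derivative f (at (fst u))"
    using has_derivative_unique by blast
  then have "snd (?D (0, v)) = frechet_derivative f (at (fst u)) v" by (rule fun_cong)
  moreover have "fst (?D (0, v)) = 0"
    using linear_0[OF bounded_linear.linear[OF lin]] by (simp add: 1)
  ultimately show "?D (0, v) = (0, frechet_derivative f (at (fst u)) v)" by (simp add: prod_eq_iff)
qed

locale tangent = base: atlas A for A :: "('m, 'e::euclidean_space) chart set"
begin

section \<open>Tangent vectors and the slit atlas\<close>

lemma tangent_vectorD: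
  "\<lbrakk>w \<in> tangent_space A p; c \<in> A; c' \<in> A; p \<in> fst c; p \<in> fst c'\<rbrakk> \<Longrightarrow>
    w c' = frechet_derivative (snd c' \<circ> chart_inv c) (at (snd c p)) (w c)"
  unfolding tangent_space_def by blast

lemma tangent_vector_outside: "w \<in> tangent_space A p \<Longrightarrow> \<not> (c \<in> A \<and> p \<in> fst c) \<Longrightarrow> w c = 0"
  unfolding tangent_space_def by blast

lemma tangent_vector_eqI:
  assumes "w \<in> tangent_space A p" "w' \<in> tangent_space A p" "c \<in> A" "p \<in> fst c" "w c = w' c"
  shows "w = w'"
proof
  fix c'
  show "w c' = w' c'"
  proof (cases "c' \<in> A \<and> p \<in> fst c'")
    case True
    then show ?thesis
      using tangent_vectorD[OF assms(1,3) _ assms(4)] tangent_vectorD[OF assms(2,3) _ assms(4)] assms(5) by simp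
  next
    case False
    then show ?thesis using assms(1,2) by (simp add: tangent_vector_outside)
  qed
qed

lemma zero_tangent: "0 \<in> tangent_space A p"
  unfolding tangent_space_def by (simp add: linear_0[OF base.linear_transition])

text \<open>The vector a is transported to the other charts by the transition derivatives; the chain
  rule is the cocycle condition required of a tangent vector.\<close>

lemma tangent_vector_exists:
  fixes a :: 'e
  assumes c: "c \<in> A" "p \<in> fst c"
  obtains w where "w \<in> tangent_space A p" "w c = a"
proof
  define w where "w = (\<lambda>d. if d \<in> A \<and> p \<in> fst d
    then frechet_derivative (snd d \<circ> chart_inv c) (at (snd c p)) a else 0)"
  show "w \<in> tangent_space A p"
    unfolding tangent_space_def
  proof (intro CollectI conjI ballI allI impI)
    fix d d' assume d: "d \<in> A" "d' \<in> A" "p \<in> fst d \<inter> fst d'"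
    have "(snd d' \<circ> chart_inv d) differentiable (at (snd d p))"
      using d by (intro smooth_on_differentiable[OF base.smooth_transition]) auto
    then have "frechet_derivative (snd d' \<circ> chart_inv c) (at (snd c p)) a =
        frechet_derivative (snd d' \<circ> chart_inv d) (at (snd d p))
          (frechet_derivative (snd d \<circ> chart_inv c) (at (snd c p)) a)"
      using base.transition_chain[of c d p "snd d'" a] c d by blast
    moreover have "w d = frechet_derivative (snd d \<circ> chart_inv c) (at (snd c p)) a"
      and "w d' = frechet_derivative (snd d' \<circ> chart_inv c) (at (snd c p)) a"
      using d by (simp_all add: w_def)
    ultimately show "w d' = frechet_derivative (snd d' \<circ> chart_inv d) (at (snd d p)) (w d)" by metis
  qed (auto simp: w_def)
  have "frechet_derivative (snd c \<circ> chart_inv c) (at (snd c p)) = frechet_derivative (\<lambda>z. z) (at (snd c p))"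
    by (rule frechet_derivative_cong_open[OF base.open_image[OF c(1)]]) (use c in auto)
  then show "w c = a" using c by (simp add: w_def)
qed

lemma slit_chart_simps [simp]:
  "(p, w) \<in> fst (slit_chart A c) \<longleftrightarrow> p \<in> fst c \<and> w \<in> tangent_space A p \<and> w \<noteq> 0"
  "snd (slit_chart A c) (p, w) = (snd c p, w c)"
  by (simp_all add: slit_chart_def)

lemma inj_on_slit_chart:
  assumes "c \<in> A"
  shows "inj_on (snd (slit_chart A c)) (fst (slit_chart A c))"
proof (rule inj_onI, clarify)
  fix p w q x
  assume h: "(p, w) \<in> fst (slit_chart A c)" "(q, x) \<in> fst (slit_chart A c)"
    "snd (slit_chart A c) (p, w) = snd (slit_chart A c) (q, x)"
  then have "p = q" using base.chart_inv_snd[OF assms] by (metis fst_conv slit_chart_simps)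
  moreover from this h have "w \<in> tangent_space A p" "x \<in> tangent_space A p" "p \<in> fst c" "w c = x c" by auto
  ultimately show "p = q \<and> w = x" using tangent_vector_eqI assms by blast
qed

text \<open>A tangent vector vanishes as soon as one representative does, so removing the zero
  section removes exactly the fibre coordinate 0. The product form yields openness of the
  overlaps.\<close>

lemma slit_overlap:
  assumes c: "c \<in> A" "c' \<in> A"
  shows "snd (slit_chart A c) ` (fst (slit_chart A c) \<inter> fst (slit_chart A c')) =
    (snd c ` (fst c \<inter> fst c')) \<times> (- {0 :: 'e})"
proof (intro equalityI subsetI)
  fix u assume "u \<in> snd (slit_chart A c) ` (fst (slit_chart A c) \<inter> fst (slit_chart A c'))"
  then obtain p w where "u = (snd c p, w c)" and w: "p \<in> fst c" "p \<in> fst c'" "w \<in> tangent_space A p" "w \<noteq> 0"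
    by auto
  moreover have "w c \<noteq> 0" using tangent_vector_eqI[OF w(3) zero_tangent c(1) w(1)] w(4) by auto
  ultimately show "u \<in> (snd c ` (fst c \<inter> fst c')) \<times> (- {0 :: 'e})" by auto
next
  fix u assume "u \<in> (snd c ` (fst c \<inter> fst c')) \<times> (- {0 :: 'e})"
  then obtain p a where u: "u = (snd c p, a)" and p: "p \<in> fst c" "p \<in> fst c'" "a \<noteq> 0" by auto
  obtain w where "w \<in> tangent_space A p" "w c = a" using tangent_vector_exists[OF c(1) p(1)] by blast
  then show "u \<in> snd (slit_chart A c) ` (fst (slit_chart A c) \<inter> fst (slit_chart A c'))"
    using u p by (intro image_eqI[of _ _ "(p, w)"]) auto
qed

lemma slit_transition:
  assumes c: "c \<in> A" "c' \<in> A" and u: "u \<in> (snd c ` (fst c \<inter> fst c')) \<times> (- {0 :: 'e})"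
  shows "(snd (slit_chart A c') \<circ> chart_inv (slit_chart A c)) u =
    ((snd c' \<circ> chart_inv c) (fst u), frechet_derivative (snd c' \<circ> chart_inv c) (at (fst u)) (snd u))"
proof -
  obtain p w where q: "(p, w) \<in> fst (slit_chart A c)" "(p, w) \<in> fst (slit_chart A c')" "u = snd (slit_chart A c) (p, w)"
    using u unfolding slit_overlap[OF c, symmetric] by auto
  have "chart_inv (slit_chart A c) u = (p, w)"
    unfolding chart_inv_def q(3) using inv_into_f_f[OF inj_on_slit_chart[OF c(1)] q(1)] .
  then show ?thesis using q c tangent_vectorD[of w p c c'] by simp
qed

lemma smooth_atlas_slit: "smooth_atlas (slit_atlas A)"
  unfolding smooth_atlas_def
proof (intro ballI conjI)
  fix d assume "d \<in> slit_atlas A"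
  then show "inj_on (snd d) (fst d)" using inj_on_slit_chart by (auto simp: slit_atlas_def)
next
  fix d d' assume "d \<in> slit_atlas A" "d' \<in> slit_atlas A"
  then obtain c c' where d: "d = slit_chart A c" "d' = slit_chart A c'" and c: "c \<in> A" "c' \<in> A"
    by (auto simp: slit_atlas_def)
  have S: "open (snd c ` (fst c \<inter> fst c'))" "open (- {0} :: 'e set)"
    by (simp_all add: base.open_overlap c open_Compl)
  show "open (snd d ` (fst d \<inter> fst d'))"
    unfolding d slit_overlap[OF c] using S by (rule open_Times)
  show "smooth_on (snd d ` (fst d \<inter> fst d')) (snd d' \<circ> chart_inv d)"
    unfolding d slit_overlap[OF c]
    by (rule smooth_on_cong[OF smooth_on_tangent_map[OF base.smooth_transition[OF c] S] open_Times[OF S]])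
      (use slit_transition[OF c] in simp)
qed

end

sublocale tangent \<subseteq> slit: atlas "slit_atlas A"
  by unfold_locales (rule smooth_atlas_slit)

context tangent
begin

text \<open>Here L is the derivative of the base transition. Its appearance in both diagonal blocks
  makes J a tensor; its action on the fibre coordinate makes the Liouville field well
  defined.\<close>

lemma slit_transition_derivative:
  assumes c: "c \<in> slit_atlas A" "c' \<in> slit_atlas A" and q: "q \<in> fst c" "q \<in> fst c'"
  obtains L where "linear L"
    "\<And>h. fst (frechet_derivative (snd c' \<circ> chart_inv c) (at (snd c q)) h) = L (fst h)"
    "\<And>v. frechet_derivative (snd c' \<circ> chart_inv c) (at (snd c q)) (0, v) = (0, L v)"
    "snd (snd c' q) = L (snd (snd c q))"
proof -
  from c obtain d d' where d: "c = slit_chart A d" "c' = slit_chart A d'" "d \<in> A" "d' \<in> A"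
    by (auto simp: slit_atlas_def)
  obtain p w where pw: "q = (p, w)" by fastforce
  let ?S = "snd d ` (fst d \<inter> fst d')" and ?\<phi> = "snd d' \<circ> chart_inv d"
  have S: "open ?S" "open (- {0} :: 'e set)" by (simp_all add: base.open_overlap d open_Compl)
  have u: "snd c q \<in> ?S \<times> (- {0 :: 'e})"
    unfolding slit_overlap[OF d(3,4), symmetric] using q d by auto
  have eq: "frechet_derivative (snd c' \<circ> chart_inv c) (at (snd c q)) =
      frechet_derivative (\<lambda>u. (?\<phi> (fst u), frechet_derivative ?\<phi> (at (fst u)) (snd u))) (at (snd c q))"
    unfolding d using slit_transition[OF d(3,4)] u[unfolded d]
    by (intro frechet_derivative_cong_open[OF open_Times[OF S]]) auto
  show ?thesis
  proof (rule that[of "frechet_derivative ?\<phi> (at (fst (snd c q)))"])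
    show "linear (frechet_derivative ?\<phi> (at (fst (snd c q))))"
      using base.linear_transition[OF d(3,4), of p] q by (simp add: d(1,2) pw)
    show "snd (snd c' q) = frechet_derivative ?\<phi> (at (fst (snd c q))) (snd (snd c q))"
      using tangent_vectorD[of w p d d'] q d by (simp add: pw)
  qed (simp_all only: eq tangent_map_derivative[OF base.smooth_transition[OF d(3,4)] S u])
qed

section \<open>The tangent structure J and the Liouville field\<close>

lemma rep_J: "rep c (tangent_J X) = (\<lambda>z. (0, fst (rep c X z)))"
  by (simp add: rep_def tangent_J_def)

lemma bounded_linear_J: "bounded_linear (\<lambda>h :: 'e \<times> 'e. (0 :: 'e, fst h))"
  by (intro bounded_linear_Pair bounded_linear_zero bounded_linear_fst)

lemma field_J:
  assumes X: "X \<in> slit_fields A"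
  shows "tangent_J X \<in> slit_fields A"
proof (rule slit.vector_fieldI)
  fix q c c' assume c: "c \<in> slit_atlas A" "c' \<in> slit_atlas A" "q \<in> fst c" "q \<in> fst c'"
  then obtain L where
    "\<And>h. fst (frechet_derivative (snd c' \<circ> chart_inv c) (at (snd c q)) h) = L (fst h)"
    "\<And>v. frechet_derivative (snd c' \<circ> chart_inv c) (at (snd c q)) (0, v) = (0, L v)"
    by (rule slit_transition_derivative) blast
  then show "tangent_J X q c' = frechet_derivative (snd c' \<circ> chart_inv c) (at (snd c q)) (tangent_J X q c)"
    using slit.field_transition[OF X c] by (simp add: tangent_J_def)
next
  show "smooth_on (snd c ` fst c) (rep c (tangent_J X))" if "c \<in> slit_atlas A" for c
    unfolding rep_J
    by (rule smooth_on_bounded_linear[OF slit.smooth_rep[OF X that] slit.open_image[OF that] bounded_linear_J])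
qed (simp add: tangent_J_def slit.field_outside[OF X] zero_prod_def)

lemma rep_liouville:
  "c \<in> slit_atlas A \<Longrightarrow> z \<in> snd c ` fst c \<Longrightarrow> rep c (liouville A) z = (0, snd z)"
  by (auto simp: rep_def liouville_def)

lemma field_liouville: "liouville A \<in> slit_fields A"
proof (rule slit.vector_fieldI)
  fix q c c' assume c: "c \<in> slit_atlas A" "c' \<in> slit_atlas A" "q \<in> fst c" "q \<in> fst c'"
  then obtain L where
    "\<And>v. frechet_derivative (snd c' \<circ> chart_inv c) (at (snd c q)) (0, v) = (0, L v)"
    "snd (snd c' q) = L (snd (snd c q))"
    by (rule slit_transition_derivative) blast
  then show "liouville A q c' = frechet_derivative (snd c' \<circ> chart_inv c) (at (snd c q)) (liouville A q c)"
    using c by (simp add: liouville_def)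
next
  show "smooth_on (snd c ` fst c) (rep c (liouville A))" if "c \<in> slit_atlas A" for c
  proof (rule smooth_on_cong)
    show "smooth_on (snd c ` fst c) (\<lambda>z. (0, snd z))"
      by (rule smooth_on_bounded_linear[OF smooth_on_ident slit.open_image[OF that]])
        (intro bounded_linear_Pair bounded_linear_zero bounded_linear_snd)
  qed (use that rep_liouville slit.open_image in auto)
qed (auto simp: liouville_def)

lemma J_liouville [simp]: "tangent_J (liouville A) = 0"
  by (auto simp: tangent_J_def liouville_def fun_eq_iff zero_prod_def)

lemma J_add [simp]: "tangent_J (X + Y) = tangent_J X + tangent_J Y"
  and J_diff [simp]: "tangent_J (X - Y) = tangent_J X - tangent_J Y"
  and J_uminus [simp]: "tangent_J (- X) = - tangent_J X"
  and J_zero [simp]: "tangent_J 0 = 0"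
  and J_J [simp]: "tangent_J (tangent_J X) = 0"
  and J_scale [simp]: "tangent_J (fmult f X) = fmult f (tangent_J X)"
  by (auto simp: tangent_J_def fun_eq_iff fmult_def prod_eq_iff)

lemma dir_deriv_J:
  assumes "Y \<in> slit_fields A" "c \<in> slit_atlas A" "q \<in> fst c"
  shows "dir_deriv X (rep c (tangent_J Y)) (snd c q) = (0, fst (dir_deriv X (rep c Y) (snd c q)))"
  unfolding rep_J using assms
  by (intro dir_deriv_bounded_linear[OF bounded_linear_J] slit.differentiable_rep) auto

lemma dir_deriv_liouville:
  assumes "c \<in> slit_atlas A" "q \<in> fst c"
  shows "dir_deriv X (rep c (liouville A)) (snd c q) = (0, snd (X (snd c q)))"
proof -
  have "dir_deriv X (rep c (liouville A)) (snd c q) = dir_deriv X (\<lambda>z. (0, snd z)) (snd c q)"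
    by (rule dir_deriv_cong[OF slit.open_image[OF assms(1)] imageI[OF assms(2)] rep_liouville[OF assms(1)]])
  also have "\<dots> = (0, snd (X (snd c q)))"
    unfolding dir_deriv_def
    by (rule fun_cong[OF frechet_derivative_eqI])
      (intro bounded_linear_imp_has_derivative bounded_linear_Pair bounded_linear_zero bounded_linear_snd)
  finally show ?thesis .
qed

lemma bracket_J_apply:
  "c \<in> slit_atlas A \<Longrightarrow> q \<in> fst c \<Longrightarrow>
    tangent_J (slit_bracket A X Y) q c = (0, fst (coord_bracket (rep c X) (rep c Y) (snd c q)))"
  by (simp add: tangent_J_def slit.lie_bracket_apply)

text \<open>Vanishing of the Nijenhuis tensor of J: in induced coordinates J has constant
  coefficients and commutes with differentiation, and the other terms contain J J = 0.\<close>

lemma nijenhuis_J: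
  assumes "X \<in> slit_fields A" "Y \<in> slit_fields A"
  shows "slit_bracket A (tangent_J X) (tangent_J Y) =
    tangent_J (slit_bracket A (tangent_J X) Y) + tangent_J (slit_bracket A X (tangent_J Y))"
proof (rule slit.field_eqI)
  fix q c assume "c \<in> slit_atlas A" "q \<in> fst c"
  then show "slit_bracket A (tangent_J X) (tangent_J Y) q c =
    (tangent_J (slit_bracket A (tangent_J X) Y) + tangent_J (slit_bracket A X (tangent_J Y))) q c"
    using assms by (simp add: bracket_J_apply slit.lie_bracket_apply coord_bracket_def dir_deriv_J)
qed (intro slit.field_add field_J slit.field_lie_bracket assms)+

text \<open>Says that the Lie derivative of J along the Liouville field is -J. The extra term arises
  because the Liouville field is the identity on fibres, so its derivative along JX is JX.\<close>

lemma liouville_J: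
  assumes "X \<in> slit_fields A"
  shows "slit_bracket A (liouville A) (tangent_J X) =
    tangent_J (slit_bracket A (liouville A) X) - tangent_J X"
proof (rule slit.field_eqI)
  fix q c assume c: "c \<in> slit_atlas A" "q \<in> fst c"
  then show "slit_bracket A (liouville A) (tangent_J X) q c =
    (tangent_J (slit_bracket A (liouville A) X) - tangent_J X) q c"
    using assms slit.rep_snd[OF c, of X]
    by (simp add: bracket_J_apply slit.lie_bracket_apply coord_bracket_def dir_deriv_J dir_deriv_liouville)
      (simp add: rep_def tangent_J_def)
qed (intro slit.field_diff field_J field_liouville slit.field_lie_bracket assms)+

text \<open>The base component of S is the fibre coordinate, whose derivative along X is the fibre
  component of X, and the base component of X is 0. Thus [X, S] is a global preimage of X under
  J.\<close>

lemma vertical_eq_J: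
  assumes X: "X \<in> slit_fields A" "tangent_J X = 0" and S: "S \<in> slit_fields A" "tangent_J S = liouville A"
  shows "X = tangent_J (slit_bracket A X S)"
proof (rule slit.field_eqI)
  fix q c assume c: "c \<in> slit_atlas A" "q \<in> fst c"
  have "(0, fst (dir_deriv (rep c S) (rep c X) (snd c q))) = dir_deriv (rep c S) (rep c (tangent_J X)) (snd c q)"
    using dir_deriv_J[OF X(1) c] by simp
  also have "\<dots> = 0" by (simp add: X(2) rep_def dir_deriv_def zero_fun_def[symmetric] zero_prod_def)
  finally have 1: "fst (dir_deriv (rep c S) (rep c X) (snd c q)) = 0" by (simp add: prod_eq_iff)
  have "(0, fst (dir_deriv (rep c X) (rep c S) (snd c q))) = dir_deriv (rep c X) (rep c (tangent_J S)) (snd c q)"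
    using dir_deriv_J[OF S(1) c] by simp
  also have "\<dots> = (0, snd (X q c))" unfolding S(2) using dir_deriv_liouville[OF c] slit.rep_snd[OF c] by simp
  finally have 2: "fst (dir_deriv (rep c X) (rep c S) (snd c q)) = snd (X q c)" by simp
  have "tangent_J X q c = 0" using X(2) by simp
  then have "fst (X q c) = 0" by (simp add: tangent_J_def prod_eq_iff)
  then show "X q c = tangent_J (slit_bracket A X S) q c"
    using c 1 2 by (simp add: slit.lie_bracket_apply tangent_J_def coord_bracket_def prod_eq_iff)
qed (intro field_J slit.field_lie_bracket X S)+

end

section \<open>The Barthel connection of a Finsler manifold\<close>

locale finsler = tangent A for A :: "('m, 'e::euclidean_space) chart set" +
  fixes E :: "('m, 'e) tpoint \<Rightarrow> real" and S :: "('m, 'e) tfield"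
  assumes finsler: "finsler_manifold A E" and spray: "canonical_spray A E S"
begin

abbreviation "\<X> \<equiv> slit_fields A"
abbreviation "J \<equiv> tangent_J :: ('m, 'e) tfield \<Rightarrow> ('m, 'e) tfield"
abbreviation "br \<equiv> slit_bracket A"
abbreviation "TM0 \<equiv> carrier (slit_atlas A)"
abbreviation "\<D> \<equiv> deriv_along (slit_atlas A)"
abbreviation "\<Omega> \<equiv> fundamental_form A E"
abbreviation "\<h> \<equiv> hor A S"
abbreviation "\<v> \<equiv> ver A S"
abbreviation "\<Gamma> \<equiv> barthel A S"
abbreviation "smooth \<equiv> smooth_fun (slit_atlas A)"

section \<open>The fundamental form and the spray\<close>

lemma smooth_E: "smooth E"
  using finsler by (simp add: finsler_manifold_def)

lemma S_field: "S \<in> \<X>"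
  using spray by (simp add: canonical_spray_def)

lemmas fields = slit.field_zero slit.field_add slit.field_diff slit.field_uminus slit.field_lie_bracket
  field_J field_liouville S_field

lemmas smooth_intros = slit.smooth_deriv_along smooth_E slit.smooth_fun_add slit.smooth_fun_diff

lemma omega_apply:
  "\<Omega> X Y u = \<D> X (\<D> (J Y) E) u - \<D> Y (\<D> (J X) E) u - \<D> (J (br X Y)) E u"
proof -
  have "d_J A E Z = \<D> (J Z) E" for Z by (simp add: d_J_def fun_eq_iff)
  then show ?thesis by (simp add: fundamental_form_def ext_deriv_def)
qed

lemma smooth_omega:
  assumes "X \<in> \<X>" "Y \<in> \<X>"
  shows "smooth (\<Omega> X Y)"
proof -
  have "\<Omega> X Y = \<D> X (\<D> (J Y) E) - \<D> Y (\<D> (J X) E) - \<D> (J (br X Y)) E"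
    by (auto simp: omega_apply fun_eq_iff)
  then show ?thesis using assms by (simp add: smooth_intros fields)
qed

lemma deriv_field_uminus:
  assumes "smooth f" "X \<in> \<X>" "u \<in> TM0"
  shows "\<D> (- X) f u = - \<D> X f u"
  using slit.deriv_along_field_diff[OF assms(1) slit.field_zero assms(2,3)]
    slit.deriv_along_field_zero[OF assms(1,3)] by simp

lemma deriv_J_zero:
  assumes "X \<in> \<X>" "u \<in> TM0"
  shows "\<D> X (\<D> 0 E) u = 0"
proof -
  have "\<D> X (\<D> 0 E) u = \<D> X (\<lambda>_. 0) u"
    by (rule slit.deriv_along_cong[OF slit.deriv_along_field_zero[OF smooth_E] assms(2)])
  then show ?thesis by (simp add: slit.deriv_along_const assms)
qed

lemma omega_skew:
  assumes "X \<in> \<X>" "Y \<in> \<X>" "u \<in> TM0"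
  shows "\<Omega> X Y u = - \<Omega> Y X u"
proof -
  have "\<D> (J (br X Y)) E u = - \<D> (J (br Y X)) E u"
    using deriv_field_uminus[OF smooth_E, of "J (br Y X)" u] slit.lie_bracket_skew[of X Y] assms
    by (simp add: fields)
  then show ?thesis by (simp add: omega_apply)
qed

lemma omega_diff_left:
  assumes "X \<in> \<X>" "Y \<in> \<X>" "Z \<in> \<X>" "u \<in> TM0"
  shows "\<Omega> (X - Y) Z u = \<Omega> X Z u - \<Omega> Y Z u"
proof -
  have "\<D> Z (\<D> (J X - J Y) E) u = \<D> Z (\<D> (J X) E - \<D> (J Y) E) u"
    using assms by (intro slit.deriv_along_cong) (simp_all add: slit.deriv_along_field_diff smooth_intros fields)
  then show ?thesis
    using assms by (simp add: omega_apply slit.deriv_along_field_diff slit.deriv_along_diff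
        slit.lie_bracket_diff_left smooth_intros fields)
qed

lemma omega_zero_left: "Z \<in> \<X> \<Longrightarrow> u \<in> TM0 \<Longrightarrow> \<Omega> 0 Z u = 0"
  using omega_diff_left[of 0 0 Z u] by (simp add: fields)

lemma omega_uminus_left: "X \<in> \<X> \<Longrightarrow> Z \<in> \<X> \<Longrightarrow> u \<in> TM0 \<Longrightarrow> \<Omega> (- X) Z u = - \<Omega> X Z u"
  using omega_diff_left[of 0 X Z u] by (simp add: fields omega_zero_left)

lemma omega_add_left:
  assumes "X \<in> \<X>" "Y \<in> \<X>" "Z \<in> \<X>" "u \<in> TM0"
  shows "\<Omega> (X + Y) Z u = \<Omega> X Z u + \<Omega> Y Z u"
  using omega_diff_left[of X "- Y" Z u] assms by (simp add: fields omega_uminus_left)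

lemma omega_diff_right:
  assumes "X \<in> \<X>" "Y \<in> \<X>" "Z \<in> \<X>" "u \<in> TM0"
  shows "\<Omega> Z (X - Y) u = \<Omega> Z X u - \<Omega> Z Y u"
  using omega_diff_left[OF assms] assms by (simp add: omega_skew[of Z] fields)

lemmas omega_linear = omega_zero_left omega_uminus_left omega_add_left omega_diff_left omega_diff_right

lemma omega_eqI:
  assumes "X \<in> \<X>" "Y \<in> \<X>" "\<And>Z u. Z \<in> \<X> \<Longrightarrow> u \<in> TM0 \<Longrightarrow> \<Omega> X Z u = \<Omega> Y Z u"
  shows "X = Y"
proof (rule slit.field_eq_carrierI[OF assms(1,2)])
  fix u assume u: "u \<in> TM0"
  have "maximal_rank (slit_atlas A) \<Omega>" using finsler by (simp add: finsler_manifold_def)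
  moreover have "\<forall>Z\<in>\<X>. \<Omega> (X - Y) Z u = 0" using assms u by (simp add: omega_linear)
  ultimately have "(X - Y) u = 0"
    using u slit.field_diff[OF assms(1,2)] unfolding maximal_rank_def by blast
  then show "X u = Y u" by (simp add: fun_diff_def fun_eq_iff)
qed

lemma J_bracket_J: "X \<in> \<X> \<Longrightarrow> Y \<in> \<X> \<Longrightarrow> J (br (J X) (J Y)) = 0"
  by (simp add: nijenhuis_J)

lemma omega_J_left:
  assumes "X \<in> \<X>" "Y \<in> \<X>" "u \<in> TM0"
  shows "\<Omega> (J X) Y u = \<D> (J X) (\<D> (J Y) E) u - \<D> (J (br (J X) Y)) E u"
  using assms by (simp add: omega_apply deriv_J_zero)

text \<open>The vertical bundle is isotropic for \<Omega>: two terms contain J J = 0, and the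
  bracket of two J-images is vertical.\<close>

lemma omega_J_J: "X \<in> \<X> \<Longrightarrow> Y \<in> \<X> \<Longrightarrow> u \<in> TM0 \<Longrightarrow> \<Omega> (J X) (J Y) u = 0"
  by (simp add: omega_apply deriv_J_zero J_bracket_J slit.deriv_along_field_zero smooth_E fields)

text \<open>The skew part is [JX, JY]E minus the two bracket corrections, which add up to the same
  field by \<open>nijenhuis_J\<close>.\<close>

lemma omega_J_sym:
  assumes "X \<in> \<X>" "Y \<in> \<X>" "u \<in> TM0"
  shows "\<Omega> (J X) Y u = \<Omega> (J Y) X u"
proof -
  have "br (J X) (J Y) = J (br (J X) Y) - J (br (J Y) X)"
    using nijenhuis_J[OF assms(1,2)] slit.lie_bracket_skew[of X "J Y"] by simp
  then have "\<D> (br (J X) (J Y)) E u = \<D> (J (br (J X) Y)) E u - \<D> (J (br (J Y) X)) E u"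
    using assms by (simp add: slit.deriv_along_field_diff smooth_E fields)
  then show ?thesis
    using assms by (simp add: omega_J_left slit.deriv_along_lie_bracket smooth_E fields)
qed

text \<open>Homogeneity gives \<open>i\<^sub>C\<Omega> = d\<^sub>JE\<close>, while \<open>i\<^sub>S\<Omega> = -dE\<close> and the symmetry of
  \<open>(X, Y) \<mapsto> \<Omega>(JX, Y)\<close> give the same value for \<open>i\<^sub>J\<^sub>S\<Omega>\<close>.\<close>

lemma J_spray: "J S = liouville A"
proof (rule omega_eqI)
  fix X u assume X: "X \<in> \<X>" and u: "u \<in> TM0"
  let ?C = "liouville A"
  have "\<D> (J X) (\<D> ?C E) u = \<D> (J X) (E + E) u"
    using finsler u by (intro slit.deriv_along_cong) (auto simp: finsler_manifold_def)
  also have "\<dots> = 2 * \<D> (J X) E u"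
    using slit.deriv_along_add[OF smooth_E smooth_E field_J[OF X] u] by simp
  finally have "\<D> ?C (\<D> (J X) E) u = \<D> (br ?C (J X)) E u + 2 * \<D> (J X) E u"
    using X u by (simp add: slit.deriv_along_lie_bracket smooth_E fields)
  also have "\<D> (br ?C (J X)) E u = \<D> (J (br ?C X)) E u - \<D> (J X) E u"
    using X u by (simp add: liouville_J slit.deriv_along_field_diff smooth_E fields)
  finally have "\<Omega> ?C X u = \<D> (J X) E u"
    using X u by (simp add: omega_apply deriv_J_zero)
  moreover have "\<Omega> (J S) X u = \<D> (J X) E u"
    using spray X u by (simp add: omega_J_sym[of S X] omega_skew[of "J X" S] canonical_spray_def fields)
  ultimately show "\<Omega> (J S) X u = \<Omega> ?C X u" by simp
qed (intro fields)+

lemma vertical_J: "X \<in> \<X> \<Longrightarrow> J X = 0 \<Longrightarrow> X = J (br X S)"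
  by (rule vertical_eq_J[OF _ _ S_field J_spray])

text \<open>Compare \<open>nijenhuis_J\<close> for X and S, where JS is the Liouville field, with
  \<open>liouville_J\<close>. It follows that \<Gamma> is -1 on vertical fields and that J\<Gamma> =
  J.\<close>

lemma J_bracket_spray:
  assumes X: "X \<in> \<X>"
  shows "J (br (J X) S) = J X"
proof -
  have "br (J X) (liouville A) = J (br (J X) S) + J (br X (liouville A))"
    using nijenhuis_J[OF X S_field] by (simp add: J_spray)
  then have "- br (liouville A) (J X) = J (br (J X) S) - J (br (liouville A) X)"
    using slit.lie_bracket_skew[of "J X" "liouville A"] slit.lie_bracket_skew[of X "liouville A"] by simp
  then show ?thesis by (simp add: liouville_J[OF X])
qed

section \<open>Projectors, curvature and metric of the Barthel connection\<close>

lemma barthel_field: "X \<in> \<X> \<Longrightarrow> \<Gamma> X \<in> \<X>"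
  by (simp add: barthel_def fields)

lemma barthel_diff: "X \<in> \<X> \<Longrightarrow> Y \<in> \<X> \<Longrightarrow> \<Gamma> (X - Y) = \<Gamma> X - \<Gamma> Y"
  by (simp add: barthel_def slit.lie_bracket_diff_left fields)

lemma barthel_J: "X \<in> \<X> \<Longrightarrow> \<Gamma> (J X) = - J X"
  using slit.lie_bracket_diff_left[of 0 0 S] by (simp add: barthel_def J_bracket_spray fields)

lemma J_barthel: "X \<in> \<X> \<Longrightarrow> J (\<Gamma> X) = J X"
  by (simp add: barthel_def J_bracket_spray)

lemma hor_field: "X \<in> \<X> \<Longrightarrow> \<h> X \<in> \<X>"
  by (simp add: hor_def slit.field_scale barthel_field fields)

lemma ver_field: "X \<in> \<X> \<Longrightarrow> \<v> X \<in> \<X>"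
  by (simp add: ver_def slit.field_scale barthel_field fields)

lemmas fields' = fields hor_field ver_field barthel_field

lemma hor_diff: "X \<in> \<X> \<Longrightarrow> Y \<in> \<X> \<Longrightarrow> \<h> (X - Y) = \<h> X - \<h> Y"
  by (simp add: hor_def barthel_diff fmult_def fun_eq_iff algebra_simps)

lemma hor_add: "X \<in> \<X> \<Longrightarrow> Y \<in> \<X> \<Longrightarrow> \<h> (X + Y) = \<h> X + \<h> Y"
  using hor_diff[of "X + Y" Y] by (simp add: fields)

lemma ver_diff: "X \<in> \<X> \<Longrightarrow> Y \<in> \<X> \<Longrightarrow> \<v> (X - Y) = \<v> X - \<v> Y"
  by (simp add: ver_def barthel_diff fmult_def fun_eq_iff algebra_simps)

lemma hor_plus_ver: "\<h> X + \<v> X = X"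
proof -
  have "(1/2) *\<^sub>R (x + g) + (1/2) *\<^sub>R (x - g) = x" for x g :: "'e \<times> 'e"
    unfolding scaleR_add_right[symmetric] by simp
  then show ?thesis by (simp add: hor_def ver_def fmult_def fun_eq_iff)
qed

lemma hor_J: "X \<in> \<X> \<Longrightarrow> \<h> (J X) = 0"
  by (simp add: hor_def barthel_J fmult_def fun_eq_iff)

lemma ver_J: "X \<in> \<X> \<Longrightarrow> \<v> (J X) = J X"
  using hor_plus_ver[of "J X"] by (simp add: hor_J)

lemma J_ver: "X \<in> \<X> \<Longrightarrow> J (\<v> X) = 0"
  unfolding ver_def J_scale J_diff by (simp add: J_barthel fmult_def fun_eq_iff)

lemma J_hor: "X \<in> \<X> \<Longrightarrow> J (\<h> X) = J X"
  using hor_plus_ver[of X] J_ver[of X] by (metis J_add add.right_neutral)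

lemma hor_vertical: "X \<in> \<X> \<Longrightarrow> J X = 0 \<Longrightarrow> \<h> X = 0"
  using vertical_J[of X] hor_J[of "br X S"] fields by metis

lemma ver_vertical: "X \<in> \<X> \<Longrightarrow> J X = 0 \<Longrightarrow> \<v> X = X"
  using hor_plus_ver[of X] by (simp add: hor_vertical)

lemma ver_hor:
  assumes "X \<in> \<X>"
  shows "\<v> (\<h> X) = 0"
proof -
  have "\<h> X = X - \<v> X" using hor_plus_ver[of X] by (simp add: eq_diff_eq)
  then show ?thesis using assms ver_diff[of X "\<v> X"] ver_vertical[of "\<v> X"] by (simp add: fields' J_ver)
qed

text \<open>Since [vX, vY] is vertical, h annihilates it. Expanding v = I - h there trades the three
  terms with an outer h for -h[hX, hY].\<close>

lemma barthel_curvature_eq: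
  assumes X: "X \<in> \<X>" and Y: "Y \<in> \<X>"
  shows "barthel_curvature A S X Y = - \<v> (br (\<h> X) (\<h> Y))"
proof -
  let ?W = "br (\<h> X) (\<h> Y)" and ?U = "br X Y - br (\<h> X) Y - br X (\<h> Y)"
  have v: "\<v> Z = Z - \<h> Z" for Z using hor_plus_ver[of Z] by (simp add: eq_diff_eq add.commute)
  have "\<v> X = J (br (\<v> X) S)" "\<v> Y = J (br (\<v> Y) S)"
    by (rule vertical_J; simp add: fields' J_ver X Y)+
  then have "J (br (\<v> X) (\<v> Y)) = 0"
    using J_bracket_J[of "br (\<v> X) S" "br (\<v> Y) S"] X Y fields' by metis
  then have "\<h> (br (\<v> X) (\<v> Y)) = 0"
    using X Y by (intro hor_vertical) (simp_all add: fields')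
  moreover have "br (\<v> X) (\<v> Y) = ?U + ?W"
    using X Y by (simp add: v slit.lie_bracket_diff_left slit.lie_bracket_diff_right fields')
  ultimately have "\<h> ?U + \<h> ?W = 0"
    using X Y by (simp add: hor_add fields')
  then have "\<h> (br X Y) - \<h> (br (\<h> X) Y) - \<h> (br X (\<h> Y)) = - \<h> ?W"
    using X Y by (simp add: hor_diff fields' add_eq_0_iff2)
  moreover have "barthel_curvature A S X Y =
      - (?W + (\<h> (br X Y) - \<h> (br (\<h> X) Y) - \<h> (br X (\<h> Y))))"
    by (simp add: barthel_curvature_def algebra_simps)
  ultimately show ?thesis by (simp add: v)
qed

text \<open>The chosen representative differs from Z by a vertical field, which \<Omega> does not
  see when paired with JY.\<close>

lemma vertical_metric_J:
  assumes "Y \<in> \<X>" "Z \<in> \<X>" "u \<in> TM0"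
  shows "vertical_metric A E (J Y) (J Z) u = \<Omega> (J Y) Z u"
proof -
  define W where "W = (SOME W. W \<in> \<X> \<and> J W = J Z)"
  have "\<exists>W. W \<in> \<X> \<and> J W = J Z" using assms by blast
  then have W: "W \<in> \<X> \<and> J W = J Z" unfolding W_def by (rule someI_ex)
  have "W - Z = J (br (W - Z) S)" using W assms by (intro vertical_J) (simp_all add: fields)
  moreover have "\<Omega> (J Y) (J (br (W - Z) S)) u = 0"
    using assms W by (intro omega_J_J) (simp_all add: fields)
  ultimately have "\<Omega> (J Y) (W - Z) u = 0" by metis
  then show ?thesis
    using W assms unfolding vertical_metric_def W_def[symmetric] by (simp add: omega_linear fields)
qed

text \<open>The first summand of g becomes the vertical metric on the pair J 0, J 0 and vanishes; in
  the second, v fixes J-images.\<close>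

lemma metric_J:
  assumes "Y \<in> \<X>" "Z \<in> \<X>" "u \<in> TM0"
  shows "metric A E S (J Y) (J Z) u = \<Omega> (J Y) Z u"
  using vertical_metric_J[OF assms] vertical_metric_J[OF slit.field_zero slit.field_zero assms(3)] assms
  by (simp add: metric_def ver_J omega_linear fields)

end

section \<open>Cartan tensor and vertical curvature\<close>

locale cartan_tensor = finsler A E S
  for A :: "('m, 'e::euclidean_space) chart set" and E S +
  fixes F :: "('m, 'e) tfield \<Rightarrow> ('m, 'e) tfield"
    and Ct :: "('m, 'e) tfield \<Rightarrow> ('m, 'e) tfield \<Rightarrow> ('m, 'e) tfield"
  assumes almost_complex: "almost_complex_structure A S F"
    and first_cartan: "first_cartan_tensor A E S Ct"
begin

section \<open>Algebra of F and of the first Cartan tensor\<close>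

lemma F_field: "X \<in> \<X> \<Longrightarrow> F X \<in> \<X>"
  using almost_complex by (auto simp: almost_complex_structure_def tensor11_def)

text \<open>Combines FJ = h with Jh = J. Values of the Cartan tensor can thereby be fed again into
  rules stated for J-images.\<close>

lemma J_F_vertical:
  assumes "X \<in> \<X>" "J X = 0"
  shows "J (F X) = X"
proof -
  have "F (J (br X S)) = \<h> (br X S)"
    using almost_complex assms by (simp add: almost_complex_structure_def fields)
  then show ?thesis using vertical_J[OF assms] J_hor[of "br X S"] fields assms by metis
qed

lemma F_uminus: "X \<in> \<X> \<Longrightarrow> F (- X) = - F X"
proof -
  assume X: "X \<in> \<X>"
  have add: "F (X + Y) = F X + F Y" if "X \<in> \<X>" "Y \<in> \<X>" for X Y
    using that almost_complex by (simp add: almost_complex_structure_def tensor11_def)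
  have "F 0 = 0" using add[of 0 0] by (simp add: fields)
  then show ?thesis using add[of X "- X"] X by (simp add: fields add_eq_0_iff)
qed

lemma Ct_tensor: "tensor12 (slit_atlas A) Ct"
  using first_cartan by (simp add: first_cartan_tensor_def)

lemma Ct_field: "X \<in> \<X> \<Longrightarrow> Y \<in> \<X> \<Longrightarrow> Ct X Y \<in> \<X>"
  using Ct_tensor by (simp add: tensor12_def tensor11_def)

lemma J_Ct: "X \<in> \<X> \<Longrightarrow> Y \<in> \<X> \<Longrightarrow> J (Ct X Y) = 0"
  using first_cartan by (simp add: first_cartan_tensor_def)

lemma Ct_add_left: "X \<in> \<X> \<Longrightarrow> Y \<in> \<X> \<Longrightarrow> Z \<in> \<X> \<Longrightarrow> Ct (X + Y) Z = Ct X Z + Ct Y Z"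
  using Ct_tensor by (simp add: tensor12_def tensor11_def)

lemma Ct_add_right: "X \<in> \<X> \<Longrightarrow> Y \<in> \<X> \<Longrightarrow> Z \<in> \<X> \<Longrightarrow> Ct X (Y + Z) = Ct X Y + Ct X Z"
  using Ct_tensor by (simp add: tensor12_def tensor11_def)

lemma Ct_diff_left:
  assumes "X \<in> \<X>" "Y \<in> \<X>" "Z \<in> \<X>"
  shows "Ct (X - Y) Z = Ct X Z - Ct Y Z"
  using Ct_add_left[OF slit.field_diff[OF assms(1,2)] assms(2,3)] by (simp add: algebra_simps)

lemma Ct_uminus_left: "X \<in> \<X> \<Longrightarrow> Z \<in> \<X> \<Longrightarrow> Ct (- X) Z = - Ct X Z"
  using Ct_diff_left[of 0 X Z] Ct_diff_left[of 0 0 Z] by (simp add: fields)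

lemmas fields'' = fields' F_field Ct_field

abbreviation "G X Y \<equiv> \<Omega> (J X) Y"

lemma deriv_G_sym:
  assumes "X \<in> \<X>" "Y \<in> \<X>" "Z \<in> \<X>" "u \<in> TM0"
  shows "\<D> X (G Y Z) u = \<D> X (G Z Y) u"
  using assms by (intro slit.deriv_along_cong omega_J_sym)

lemma omega_Ct:
  assumes "X \<in> \<X>" "Y \<in> \<X>" "Z \<in> \<X>" "u \<in> TM0"
  shows "2 * \<Omega> (Ct X Y) Z u = \<D> (J X) (G Y Z) u - G (br (J X) Y) Z u - G Y (br (J X) Z) u"
proof -
  have "\<D> (J X) (metric A E S (J Y) (J Z)) u = \<D> (J X) (G Y Z) u"
    using assms by (intro slit.deriv_along_cong metric_J)
  moreover have "2 * \<Omega> (Ct X Y) Z u =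
      lie_deriv02 (slit_atlas A) (J X) (\<lambda>Y Z. metric A E S (J Y) (J Z)) Y Z u"
    using first_cartan assms by (simp add: first_cartan_tensor_def mult.commute)
  ultimately show ?thesis using assms by (simp add: lie_deriv02_def metric_J fields)
qed

text \<open>The lowered Cartan tensor is half a Lie derivative of \<open>G\<close>, and
  \<open>G\<close> is symmetric.\<close>

lemma omega_Ct_swap:
  assumes "X \<in> \<X>" "Y \<in> \<X>" "Z \<in> \<X>" "u \<in> TM0"
  shows "\<Omega> (Ct X Y) Z u = \<Omega> (Ct X Z) Y u"
proof -
  have "2 * \<Omega> (Ct X Y) Z u = 2 * \<Omega> (Ct X Z) Y u"
    using assms by (simp only: omega_Ct deriv_G_sym[OF _ assms(2,3)] omega_J_sym[of "br (J X) Y" Z]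
        omega_J_sym[of Y "br (J X) Z"] fields)
  then show ?thesis by simp
qed

lemma bracket_J_J: "X \<in> \<X> \<Longrightarrow> Y \<in> \<X> \<Longrightarrow> br (J X) (J Y) = J (br (J X) Y - br (J Y) X)"
  using nijenhuis_J[of X Y] slit.lie_bracket_skew[of X "J Y"] by simp

text \<open>Under J this is the flatness of the derivative sending JZ to J[JX, Z]; the bracket
  [JX, JY] is rewritten as J of a field for that purpose.\<close>

lemma jacobi_J:
  assumes "X \<in> \<X>" "Y \<in> \<X>" "Z \<in> \<X>"
  shows "br (J X) (br (J Y) Z) - br (J Y) (br (J X) Z) =
    br (J (br (J X) Y)) Z - br (J (br (J Y) X)) Z"
  using slit.jacobi[of "J X" "J Y" Z] assms bracket_J_J[OF assms(1,2)]
  by (simp add: slit.lie_bracket_diff_left fields)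

lemma deriv_commutator_J:
  assumes "X \<in> \<X>" "Y \<in> \<X>" "smooth f" "u \<in> TM0"
  shows "\<D> (J X) (\<D> (J Y) f) u - \<D> (J Y) (\<D> (J X) f) u =
    \<D> (J (br (J X) Y)) f u - \<D> (J (br (J Y) X)) f u"
  using slit.deriv_along_lie_bracket[of f "J X" "J Y" u] assms bracket_J_J[OF assms(1,2)]
  by (simp add: slit.deriv_along_field_diff fields)

text \<open>In coordinates \<open>2\<Omega>(\<C>(X, Y), Z)\<close> is the third vertical derivative of \<open>E\<close>.\<close>

lemma Ct_sym:
  assumes X: "X \<in> \<X>" and Y: "Y \<in> \<X>"
  shows "Ct X Y = Ct Y X"
proof (rule omega_eqI)
  fix Z u assume Z: "Z \<in> \<X>" and u: "u \<in> TM0"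
  have expand: "2 * \<Omega> (Ct P Q) Z u =
      \<D> (J P) (\<D> (J Q) (\<D> (J Z) E)) u - \<D> (J P) (\<D> (J (br (J Q) Z)) E) u
      - (\<D> (J (br (J P) Q)) (\<D> (J Z) E) u - \<D> (J (br (J (br (J P) Q)) Z)) E u)
      - (\<D> (J Q) (\<D> (J (br (J P) Z)) E) u - \<D> (J (br (J Q) (br (J P) Z))) E u)"
    if P: "P \<in> \<X>" and Q: "Q \<in> \<X>" for P Q
  proof -
    have "\<D> (J P) (G Q Z) u = \<D> (J P) (\<D> (J Q) (\<D> (J Z) E) - \<D> (J (br (J Q) Z)) E) u"
      using P Q Z u by (intro slit.deriv_along_cong) (simp_all add: omega_J_left)
    then show ?thesis
      using P Q Z u by (simp add: omega_Ct omega_J_left slit.deriv_along_diff smooth_intros fields)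
  qed
  \<comment> \<open>Of the part antisymmetric in X, Y, the first-order terms in E cancel by this
    Jacobi identity and the rest by the commutator acting on (JZ)E.\<close>
  have "\<D> (J (br (J X) (br (J Y) Z) - br (J Y) (br (J X) Z))) E u =
      \<D> (J (br (J (br (J X) Y)) Z - br (J (br (J Y) X)) Z)) E u"
    using jacobi_J[OF X Y Z] by simp
  then have "2 * \<Omega> (Ct X Y) Z u = 2 * \<Omega> (Ct Y X) Z u"
    unfolding expand[OF X Y] expand[OF Y X]
    using deriv_commutator_J[of X Y "\<D> (J Z) E" u] X Y Z u
    by (simp add: slit.deriv_along_field_diff smooth_intros fields)
  then show "\<Omega> (Ct X Y) Z u = \<Omega> (Ct Y X) Z u" by simp
qed (intro Ct_field X Y)+

section \<open>Vertical derivatives of the Cartan tensor and the v-curvature\<close>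

lemma field_lie_bracket_J: "X \<in> \<X> \<Longrightarrow> Y \<in> \<X> \<Longrightarrow> br (J X) Y \<in> \<X>"
  by (intro fields)

text \<open>The Lie derivative along JX of the Cartan tensor lowered by \<Omega>, evaluated at Y, Z,
  W.\<close>

definition lie_Ct :: "('m, 'e) tfield \<Rightarrow> ('m, 'e) tfield \<Rightarrow> ('m, 'e) tfield \<Rightarrow> ('m, 'e) tfield \<Rightarrow> ('m, 'e) tpoint \<Rightarrow> real"
  where "lie_Ct X Y Z W u = \<D> (J X) (\<Omega> (Ct Y Z) W) u - \<Omega> (Ct (br (J X) Y) Z) W u
    - \<Omega> (Ct Y (br (J X) Z)) W u - \<Omega> (Ct Y Z) (br (J X) W) u"

text \<open>\<open>2\<Omega>(\<C>(Y, Z), W)\<close> is the Lie derivative of \<open>G\<close> along \<open>JY\<close>, so the antisymmetric part of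
  \<open>lie_Ct\<close> in \<open>X, Y\<close> is \<open>[\<L>\<^bsub>JX\<^esub>, \<L>\<^bsub>JY\<^esub>] - \<L>\<^bsub>[JX, JY]\<^esub> = 0\<close> applied to \<open>G\<close>.\<close>

lemma lie_Ct_sym:
  assumes X: "X \<in> \<X>" and Y: "Y \<in> \<X>" and Z: "Z \<in> \<X>" and W: "W \<in> \<X>" and u: "u \<in> TM0"
  shows "lie_Ct X Y Z W u = lie_Ct Y X Z W u"
proof -
  have expand: "2 * lie_Ct P Q Z W u =
      \<D> (J P) (\<D> (J Q) (G Z W)) u - \<D> (J P) (G (br (J Q) Z) W) u - \<D> (J P) (G Z (br (J Q) W)) u
      - (\<D> (J (br (J P) Q)) (G Z W) u - G (br (J (br (J P) Q)) Z) W u - G Z (br (J (br (J P) Q)) W) u)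
      - (\<D> (J Q) (G (br (J P) Z) W) u - G (br (J Q) (br (J P) Z)) W u - G (br (J P) Z) (br (J Q) W) u)
      - (\<D> (J Q) (G Z (br (J P) W)) u - G (br (J Q) Z) (br (J P) W) u - G Z (br (J Q) (br (J P) W)) u)"
    if P: "P \<in> \<X>" and Q: "Q \<in> \<X>" for P Q
  proof -
    have s: "smooth (\<Omega> (Ct Q Z) W)" by (intro smooth_omega Ct_field Q Z W)
    \<comment> \<open>The factor 2 enters the derivative as a sum f + f, so that additivity
      suffices.\<close>
    have "2 * \<D> (J P) (\<Omega> (Ct Q Z) W) u = \<D> (J P) (\<Omega> (Ct Q Z) W + \<Omega> (Ct Q Z) W) u"
      unfolding slit.deriv_along_add[OF s s field_J[OF P] u] by (rule mult_2)
    also have "\<dots> = \<D> (J P) (\<D> (J Q) (G Z W) - G (br (J Q) Z) W - G Z (br (J Q) W)) u"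
    proof (rule slit.deriv_along_cong[OF _ u])
      fix q assume "q \<in> TM0"
      from omega_Ct[OF Q Z W this] show "(\<Omega> (Ct Q Z) W + \<Omega> (Ct Q Z) W) q =
          (\<D> (J Q) (G Z W) - G (br (J Q) Z) W - G Z (br (J Q) W)) q"
        unfolding plus_fun_apply minus_apply by linarith
    qed
    also have "\<dots> = \<D> (J P) (\<D> (J Q) (G Z W)) u - \<D> (J P) (G (br (J Q) Z) W) u - \<D> (J P) (G Z (br (J Q) W)) u"
      using P Q Z W u by (simp add: slit.deriv_along_diff smooth_intros smooth_omega fields'')
    finally have "2 * \<D> (J P) (\<Omega> (Ct Q Z) W) u =
        \<D> (J P) (\<D> (J Q) (G Z W)) u - \<D> (J P) (G (br (J Q) Z) W) u - \<D> (J P) (G Z (br (J Q) W)) u" .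
    then show ?thesis
      by (simp only: lie_Ct_def right_diff_distrib omega_Ct[OF field_lie_bracket_J[OF P Q] Z W u]
          omega_Ct[OF Q field_lie_bracket_J[OF P Z] W u] omega_Ct[OF Q Z field_lie_bracket_J[OF P W] u])
  qed
  have G1: "G (br (J X) (br (J Y) Z)) W u - G (br (J Y) (br (J X) Z)) W u =
      G (br (J (br (J X) Y)) Z) W u - G (br (J (br (J Y) X)) Z) W u"
    using arg_cong[OF jacobi_J[OF X Y Z], of "\<lambda>V. G V W u"] X Y Z W u
    by (simp add: omega_linear fields)
  have G2: "G Z (br (J X) (br (J Y) W)) u - G Z (br (J Y) (br (J X) W)) u =
      G Z (br (J (br (J X) Y)) W) u - G Z (br (J (br (J Y) X)) W) u"
    using arg_cong[OF jacobi_J[OF X Y W], of "\<lambda>V. G Z V u"] X Y Z W u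
    by (simp add: omega_linear fields)
  have "\<D> (J X) (\<D> (J Y) (G Z W)) u - \<D> (J Y) (\<D> (J X) (G Z W)) u =
      \<D> (J (br (J X) Y)) (G Z W) u - \<D> (J (br (J Y) X)) (G Z W) u"
    by (intro deriv_commutator_J X Y u smooth_omega field_J Z W)
  then have "2 * lie_Ct X Y Z W u = 2 * lie_Ct Y X Z W u"
    using expand[OF X Y] expand[OF Y X] G1 G2 by linarith
  then show ?thesis by simp
qed

text \<open>The Cartan tensor differentiated by the flat vertical derivative. Its value is
  represented through J by F before being differentiated, and an argument Y is replaced by [JX, Y],
  whose J-image is the derivative of JY.\<close>

definition dCt :: "('m, 'e) tfield \<Rightarrow> ('m, 'e) tfield \<Rightarrow> ('m, 'e) tfield \<Rightarrow> ('m, 'e) tfield"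
  where "dCt X Y Z = J (br (J X) (F (Ct Y Z))) - Ct (br (J X) Y) Z - Ct Y (br (J X) Z)"

text \<open>The Lie derivative of the lowered tensor also hits the metric used for lowering; this is
  the correction, read off from \<open>omega_Ct\<close> at the argument
  \<open>F (Ct Y Z)\<close>.\<close>

lemma omega_dCt:
  assumes X: "X \<in> \<X>" and Y: "Y \<in> \<X>" and Z: "Z \<in> \<X>" and W: "W \<in> \<X>" and u: "u \<in> TM0"
  shows "\<Omega> (dCt X Y Z) W u = lie_Ct X Y Z W u - 2 * \<Omega> (Ct X (F (Ct Y Z))) W u"
proof -
  have "J (F (Ct Y Z)) = Ct Y Z" using Y Z by (simp add: J_F_vertical fields'' J_Ct)
  then have "2 * \<Omega> (Ct X (F (Ct Y Z))) W u =
      \<D> (J X) (\<Omega> (Ct Y Z) W) u - G (br (J X) (F (Ct Y Z))) W u - \<Omega> (Ct Y Z) (br (J X) W) u"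
    using omega_Ct[of X "F (Ct Y Z)" W u] X Y Z W u by (simp add: fields'')
  then show ?thesis
    using X Y Z W u by (simp add: dCt_def lie_Ct_def omega_linear fields'')
qed

lemma dCt_sym:
  assumes X: "X \<in> \<X>" and Y: "Y \<in> \<X>" and Z: "Z \<in> \<X>"
  shows "dCt X Y Z + Ct X (F (Ct Y Z)) + Ct X (F (Ct Y Z)) = dCt Y X Z + Ct Y (F (Ct X Z)) + Ct Y (F (Ct X Z))"
proof (rule omega_eqI)
  have dCt: "dCt P Q Z \<in> \<X>" if "P \<in> \<X>" "Q \<in> \<X>" for P Q
    using that Z by (simp add: dCt_def fields'')
  fix W u assume "W \<in> \<X>" "u \<in> TM0"
  then show "\<Omega> (dCt X Y Z + Ct X (F (Ct Y Z)) + Ct X (F (Ct Y Z))) W u =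
      \<Omega> (dCt Y X Z + Ct Y (F (Ct X Z)) + Ct Y (F (Ct X Z))) W u"
    using X Y Z lie_Ct_sym[OF X Y Z] by (simp add: omega_linear dCt omega_dCt fields'')
qed (use X Y Z in \<open>simp_all add: dCt_def fields''\<close>)

text \<open>Only the rule on pairs of J-images is assumed, so that the formula serves the Cartan and
  the Hashiguchi connection alike.\<close>

lemma v_curvature_eq:
  assumes D: "linear_connection (slit_atlas A) D"
    and DJ: "\<And>X Y. X \<in> \<X> \<Longrightarrow> Y \<in> \<X> \<Longrightarrow> D (J X) (J Y) = J (br (J X) Y) + Ct X Y"
    and X: "X \<in> \<X>" and Y: "Y \<in> \<X>" and Z: "Z \<in> \<X>"
  shows "v_curvature A D X Y Z = Ct (F (Ct X Z)) Y - Ct (F (Ct Y Z)) X"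
proof -
  have twice: "D (J P) (D (J Q) (J Z)) = J (br (J P) (br (J Q) Z)) + J (br (J P) (F (Ct Q Z)))
      + Ct P (br (J Q) Z) + Ct P (F (Ct Q Z))" if P: "P \<in> \<X>" and Q: "Q \<in> \<X>" for P Q
  proof -
    \<comment> \<open>To apply the rule a second time the inner value must itself be a J-image; F
      provides the representative of its Cartan part.\<close>
    have "D (J Q) (J Z) = J (br (J Q) Z + F (Ct Q Z))"
      using Q Z by (simp add: DJ J_F_vertical J_Ct fields'')
    then show ?thesis
      using P Q Z by (simp add: DJ slit.lie_bracket_add_right Ct_add_right fields'' del: J_add)
        (simp add: algebra_simps)
  qed
  have e: "br (J X) Y - br (J Y) X \<in> \<X>" using X Y by (simp add: fields)
  \<comment> \<open>Jacobi brings the flat part into the form of the commutator of the two iterated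
    derivatives, where it cancels.\<close>
  have "D (br (J X) (J Y)) (J Z) = J (br (J X) (br (J Y) Z) - br (J Y) (br (J X) Z))
      + Ct (br (J X) Y) Z - Ct (br (J Y) X) Z"
    using DJ[OF e Z] X Y Z slit.jacobi[of "J X" "J Y" Z]
    by (simp add: Ct_diff_left fields'' bracket_J_J[OF X Y, symmetric] del: J_diff)
  then have "v_curvature A D X Y Z =
      dCt X Y Z - dCt Y X Z + Ct X (F (Ct Y Z)) - Ct Y (F (Ct X Z))"
    unfolding v_curvature_def curvature_def twice[OF X Y] twice[OF Y X] dCt_def
    by (simp add: algebra_simps)
  also have "\<dots> = Ct Y (F (Ct X Z)) - Ct X (F (Ct Y Z))"
    using dCt_sym[OF X Y Z] by (simp add: algebra_simps)
  finally show ?thesis using X Y Z by (simp add: Ct_sym[of Y] Ct_sym[of X "F _"] fields'')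
qed

end

section \<open>Curvatures of the Hashiguchi connection\<close>

locale hashiguchi = cartan_tensor A E S F Ct
  for A :: "('m, 'e::euclidean_space) chart set" and E S F Ct +
  fixes D0 D :: "('m, 'e) tconn"
  assumes berwald: "berwald_connection A S F D0"
    and hashiguchi: "hashiguchi_connection A E S D"
begin

section \<open>Comparison with the Berwald connection; h- and hv-curvatures\<close>

lemma D_linear: "linear_connection (slit_atlas A) D"
  and D0_linear: "linear_connection (slit_atlas A) D0"
  using hashiguchi berwald
  by (simp_all add: hashiguchi_connection_def lift_of_barthel_def berwald_connection_def)

lemma connection_field: "linear_connection (slit_atlas A) N \<Longrightarrow> X \<in> \<X> \<Longrightarrow> Y \<in> \<X> \<Longrightarrow> N X Y \<in> \<X>"
  by (simp add: linear_connection_def tensor11_def)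

lemma connection_add_left:
  "linear_connection (slit_atlas A) N \<Longrightarrow> X \<in> \<X> \<Longrightarrow> X' \<in> \<X> \<Longrightarrow> Y \<in> \<X> \<Longrightarrow> N (X + X') Y = N X Y + N X' Y"
  by (simp add: linear_connection_def tensor11_def)

lemma connection_add_right:
  "linear_connection (slit_atlas A) N \<Longrightarrow> X \<in> \<X> \<Longrightarrow> Y \<in> \<X> \<Longrightarrow> Y' \<in> \<X> \<Longrightarrow> N X (Y + Y') = N X Y + N X Y'"
  by (simp add: linear_connection_def)

lemmas D_fields = fields'' connection_field[OF D_linear] connection_field[OF D0_linear]

lemma D_J: "X \<in> \<X> \<Longrightarrow> Y \<in> \<X> \<Longrightarrow> D X (J Y) = J (D X Y)"
  using hashiguchi by (simp add: hashiguchi_connection_def lift_of_barthel_def cov_deriv11_def)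

lemma D_hor:
  assumes X: "X \<in> \<X>" and Y: "Y \<in> \<X>"
  shows "D X (\<h> Y) = \<h> (D X Y)"
proof -
  have \<Gamma>: "D X (\<Gamma> Y) = \<Gamma> (D X Y)"
    using hashiguchi X Y by (simp add: hashiguchi_connection_def lift_of_barthel_def cov_deriv11_def)
  \<comment> \<open>The Leibniz term for the constant 1/2: its derivative is known to vanish only on
    the carrier, and elsewhere the field factor is 0.\<close>
  have "fmult (\<D> X (\<lambda>_. 1/2)) (Y + \<Gamma> Y) = 0"
  proof (intro ext)
    fix u c
    show "fmult (\<D> X (\<lambda>_. 1/2)) (Y + \<Gamma> Y) u c = 0 u c"
      using slit.deriv_along_const[OF X, of u "1/2"] slit.field_outside[of "Y + \<Gamma> Y" c u] Y
        slit.in_carrier[of c u] by (cases "c \<in> slit_atlas A \<and> u \<in> fst c") (auto simp: fmult_def fields')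
  qed
  then have "D X (\<h> Y) = fmult (\<lambda>_. 1/2) (D X (Y + \<Gamma> Y))"
    unfolding hor_def using D_linear X Y slit.smooth_fun_const[of "1/2"]
    by (simp add: linear_connection_def fields')
  then show ?thesis
    using X Y by (simp add: hor_def connection_add_right[OF D_linear] \<Gamma> fields')
qed

text \<open>In the mixed torsion the term D(JY, hX) is horizontal because D commutes with h, and
  D(hX, JY) is vertical because D commutes with J. Applying v thus isolates the latter.\<close>

lemma D_hor_J:
  assumes X: "X \<in> \<X>" and Y: "Y \<in> \<X>"
  shows "D (\<h> X) (J Y) = \<v> (br (\<h> X) (J Y))"
proof -
  have "\<v> (D (\<h> X) (J Y) - D (J Y) (\<h> X) - br (\<h> X) (J Y)) = 0"
    using hashiguchi X Y by (simp add: hashiguchi_connection_def torsion_def)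
  then have "\<v> (D (\<h> X) (J Y)) - \<v> (D (J Y) (\<h> X)) = \<v> (br (\<h> X) (J Y))"
    using X Y by (simp add: ver_diff D_fields)
  moreover have "\<v> (D (\<h> X) (J Y)) = D (\<h> X) (J Y)"
    using X Y by (simp add: D_J ver_J D_fields)
  ultimately show ?thesis using X Y by (simp add: D_hor ver_hor D_fields)
qed

lemma D_hor_J_berwald: "X \<in> \<X> \<Longrightarrow> Y \<in> \<X> \<Longrightarrow> D (\<h> X) (J Y) = D0 (\<h> X) (J Y)"
  using berwald by (simp add: D_hor_J berwald_connection_def)

text \<open>Koszul's uniqueness argument: the difference of the two sides is symmetric in \<open>X, Y\<close> and, paired
  with \<open>Z\<close> by \<open>\<Omega>\<close>, antisymmetric in \<open>Y, Z\<close>.\<close>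

lemma D_J_J:
  assumes X: "X \<in> \<X>" and Y: "Y \<in> \<X>"
  shows "D (J X) (J Y) = J (br (J X) Y) + Ct X Y"
proof -
  define b where "b P Q = D (J P) (J Q) - (J (br (J P) Q) + Ct P Q)" for P Q
  have b: "b P Q \<in> \<X>" if "P \<in> \<X>" "Q \<in> \<X>" for P Q
    using that by (simp add: b_def D_fields)
  have sym: "b P Q = b Q P" if P: "P \<in> \<X>" and Q: "Q \<in> \<X>" for P Q
  proof -
    have "D (J P) (J Q) - D (J Q) (J P) = br (J P) (J Q)"
      using hashiguchi P Q by (simp add: hashiguchi_connection_def torsion_def)
    then show ?thesis
      using bracket_J_J[OF P Q] Ct_sym[OF P Q] by (simp add: b_def algebra_simps)
  qed
  \<comment> \<open>Vertical metricity and \<open>omega_Ct\<close> both compute the derivative of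
    G(Q, Z) along JP. By \<open>omega_Ct_swap\<close> the term 2 \<Omega>(Ct P Q, Z) splits evenly
    between the slots Q and Z, so nothing is left of the symmetric part of b.\<close>
  have anti: "\<Omega> (b P Q) Z u = - \<Omega> (b P Z) Q u"
    if P: "P \<in> \<X>" and Q: "Q \<in> \<X>" and Z: "Z \<in> \<X>" and u: "u \<in> TM0" for P Q Z u
  proof -
    have "\<D> (J P) (metric A E S (J Q) (J Z)) u - metric A E S (D (J P) (J Q)) (J Z) u
        - metric A E S (J Q) (D (J P) (J Z)) u = 0"
      using hashiguchi P Q Z u by (simp add: hashiguchi_connection_def cov_deriv02_def field_J)
    moreover have "\<D> (J P) (metric A E S (J Q) (J Z)) u = \<D> (J P) (G Q Z) u"
      using P Q Z u by (intro slit.deriv_along_cong metric_J)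
    ultimately have "\<D> (J P) (G Q Z) u = G (D (J P) Q) Z u + G (D (J P) Z) Q u"
      using P Q Z u omega_J_sym[of Q "D (J P) Z" u] by (simp add: D_J metric_J D_fields)
    moreover have "\<D> (J P) (G Q Z) u = 2 * \<Omega> (Ct P Q) Z u + G (br (J P) Q) Z u + G (br (J P) Z) Q u"
      using omega_Ct[OF P Q Z u] omega_J_sym[of Q "br (J P) Z" u] P Q Z u by (simp add: fields)
    ultimately show ?thesis
      using P Q Z u omega_Ct_swap[OF P Q Z u] by (simp add: b_def D_J omega_linear D_fields)
  qed
  have "b X Y = 0"
  proof (rule omega_eqI)
    fix Z u assume Z: "Z \<in> \<X>" and u: "u \<in> TM0"
    have "\<Omega> (b X Y) Z u = - \<Omega> (b Z X) Y u"
      using anti[OF X Y Z u] sym[OF X Z] by simp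
    also have "\<dots> = \<Omega> (b Y Z) X u"
      using anti[OF Z X Y u] sym[OF Y Z] by simp
    also have "\<dots> = - \<Omega> (b X Y) Z u"
      using anti[OF Y Z X u] sym[OF X Y] by simp
    finally show "\<Omega> (b X Y) Z u = \<Omega> 0 Z u" using Z u by (simp add: omega_zero_left)
  qed (intro b X Y fields)+
  then show ?thesis by (simp add: b_def)
qed

text \<open>The connections differ only through the vertical part of the direction. U is left free
  because the curvatures need different representatives: \<open>F (\<v> W)\<close> for two
  horizontal fields, \<open>D (\<h> X) Y\<close> for the mixed bracket.\<close>

lemma D_eq_berwald:
  assumes W: "W \<in> \<X>" and U: "U \<in> \<X>" "\<v> W = J U" and Z: "Z \<in> \<X>"
  shows "D W (J Z) = D0 W (J Z) + Ct U Z"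
proof -
  have split: "N W (J Z) = N (\<h> W) (J Z) + N (J U) (J Z)" if "linear_connection (slit_atlas A) N" for N
    using connection_add_left[OF that, of "\<h> W" "\<v> W" "J Z"] W Z hor_plus_ver[of W] U by (simp add: fields')
  have "D0 (J U) (J Z) = J (br (J U) Z)"
    using berwald U Z by (simp add: berwald_connection_def)
  then show ?thesis
    using W U Z by (simp add: split[OF D_linear] split[OF D0_linear] D_hor_J_berwald D_J_J)
qed

text \<open>Iterated horizontal derivatives agree, so only the term along [hX, hY] contributes. Its
  minus sign meets the one in \<R>(X, Y) = -v[hX, hY], which gives the plus in (a).\<close>

lemma h_curvature_eq:
  assumes X: "X \<in> \<X>" and Y: "Y \<in> \<X>" and Z: "Z \<in> \<X>"
  shows "h_curvature A S D X Y Z = h_curvature A S D0 X Y Z + Ct (F (barthel_curvature A S X Y)) Z"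
proof -
  \<comment> \<open>The inner derivative is again a J-image, since D commutes with J, so the
    horizontal agreement applies twice.\<close>
  have twice: "D (\<h> P) (D (\<h> Q) (J Z)) = D0 (\<h> P) (D0 (\<h> Q) (J Z))" if "P \<in> \<X>" "Q \<in> \<X>" for P Q
    using that Z D_hor_J_berwald[of P "D (\<h> Q) Z"] by (simp add: D_J D_hor_J_berwald[of Q Z, symmetric] D_fields)
  let ?W = "br (\<h> X) (\<h> Y)"
  have W: "?W \<in> \<X>" "F (\<v> ?W) \<in> \<X>" "J (F (\<v> ?W)) = \<v> ?W"
    using X Y by (simp_all add: D_fields J_F_vertical J_ver)
  have "D ?W (J Z) = D0 ?W (J Z) + Ct (F (\<v> ?W)) Z"
    using D_eq_berwald[OF W(1,2) _ Z] W(3) by simp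
  moreover have "Ct (F (barthel_curvature A S X Y)) Z = - Ct (F (\<v> ?W)) Z"
    using X Y Z W by (simp add: barthel_curvature_eq F_uminus Ct_uminus_left fields')
  ultimately show ?thesis
    by (simp add: h_curvature_def curvature_def twice[OF X Y] twice[OF Y X])
qed

text \<open>Each of the three terms of the curvature yields one correction: differentiating
  \<open>Ct Y Z\<close>, its argument Z and, through v[hX, JY] = J(D(hX, Y)), its argument Y.
  Together they form the covariant derivative of the tensor.\<close>

lemma hv_curvature_eq:
  assumes X: "X \<in> \<X>" and Y: "Y \<in> \<X>" and Z: "Z \<in> \<X>"
  shows "hv_curvature A S D X Y Z = hv_curvature A S D0 X Y Z + cov_deriv12 D (\<h> X) Ct Y Z"
proof -
  have D0: "D0 (J Y) (J Z) = J (br (J Y) Z)"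
    using berwald Y Z by (simp add: berwald_connection_def)
  have "D (\<h> X) (D (J Y) (J Z)) = D (\<h> X) (J (br (J Y) Z)) + D (\<h> X) (Ct Y Z)"
    using X Y Z by (simp add: D_J_J connection_add_right[OF D_linear] D_fields)
  then have 1: "D (\<h> X) (D (J Y) (J Z)) = D0 (\<h> X) (D0 (J Y) (J Z)) + D (\<h> X) (Ct Y Z)"
    using X Y Z by (simp add: D0 D_hor_J_berwald D_fields)
  have "D (J Y) (J (D (\<h> X) Z)) = D0 (J Y) (J (D (\<h> X) Z)) + Ct Y (D (\<h> X) Z)"
    using X Y Z by (intro D_eq_berwald) (simp_all add: ver_J D_fields)
  moreover have "J (D (\<h> X) Z) = D (\<h> X) (J Z)" using X Z by (simp add: D_J hor_field)
  ultimately have 2: "D (J Y) (D (\<h> X) (J Z)) = D0 (J Y) (D0 (\<h> X) (J Z)) + Ct Y (D (\<h> X) Z)"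
    by (simp only: D_hor_J_berwald[OF X Z])
  have "\<v> (br (\<h> X) (J Y)) = J (D (\<h> X) Y)"
    using X Y by (simp add: D_J D_hor_J[symmetric] fields')
  then have 3: "D (br (\<h> X) (J Y)) (J Z) = D0 (br (\<h> X) (J Y)) (J Z) + Ct (D (\<h> X) Y) Z"
    using X Y Z by (intro D_eq_berwald) (simp_all add: D_fields)
  show ?thesis
    unfolding hv_curvature_def curvature_def cov_deriv12_def 1 2 3 by (simp add: algebra_simps)
qed

end

theorem proposition4p11:
  fixes A :: "('m, real ^ 'n) chart set"
    and E :: "('m, real ^ 'n) tpoint \<Rightarrow> real"
    and S :: "('m, real ^ 'n) tfield"
    and F :: "('m, real ^ 'n) tfield \<Rightarrow> ('m, real ^ 'n) tfield"
    and C C' :: "('m, real ^ 'n) tfield \<Rightarrow> ('m, real ^ 'n) tfield \<Rightarrow> ('m, real ^ 'n) tfield"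
    and D_Berwald D_Cartan D_Hashiguchi :: "('m, real ^ 'n) tconn"
    and \<zeta> \<eta> \<xi> :: "('m, real ^ 'n) tfield"
  assumes "finsler_manifold A E"
    and "canonical_spray A E S"
    and "almost_complex_structure A S F"
    and "first_cartan_tensor A E S C"
    and "second_cartan_tensor A E S C'"
    and "berwald_connection A S F D_Berwald"
    and "cartan_connection A S F C C' D_Berwald D_Cartan"
    and "hashiguchi_connection A E S D_Hashiguchi"
    and "\<zeta> \<in> slit_fields A" and "\<eta> \<in> slit_fields A" and "\<xi> \<in> slit_fields A"
  shows
    "h_curvature A S D_Hashiguchi \<zeta> \<eta> \<xi> =
       h_curvature A S D_Berwald \<zeta> \<eta> \<xi> + C (F (barthel_curvature A S \<zeta> \<eta>)) \<xi>
     \<and>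
     hv_curvature A S D_Hashiguchi \<zeta> \<eta> \<xi> =
       hv_curvature A S D_Berwald \<zeta> \<eta> \<xi> + cov_deriv12 D_Hashiguchi (hor A S \<zeta>) C \<eta> \<xi>
     \<and>
     v_curvature A D_Hashiguchi \<zeta> \<eta> \<xi> = v_curvature A D_Cartan \<zeta> \<eta> \<xi>
     \<and>
     v_curvature A D_Cartan \<zeta> \<eta> \<xi> = C (F (C \<zeta> \<xi>)) \<eta> - C (F (C \<eta> \<xi>)) \<zeta>"
proof -
  have "smooth_atlas A"
    using assms(1) by (simp add: finsler_manifold_def smooth_manifold_def)
  then interpret hashiguchi A E S F C D_Berwald D_Hashiguchi
    using assms by unfold_locales
  \<comment> \<open>The Cartan connection obeys the same rule on J-images as the Hashiguchi
    connection, so \<open>v_curvature_eq\<close> evaluates both v-curvatures.\<close>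
  have "D_Cartan (tangent_J X) (tangent_J Y) = tangent_J (slit_bracket A (tangent_J X) Y) + C X Y"
    if "X \<in> slit_fields A" "Y \<in> slit_fields A" for X Y
    using assms(6,7) that by (simp add: berwald_connection_def cartan_connection_def)
  moreover have "linear_connection (slit_atlas A) D_Cartan"
    using assms(7) by (simp add: cartan_connection_def)
  ultimately have "v_curvature A D_Cartan \<zeta> \<eta> \<xi> = C (F (C \<zeta> \<xi>)) \<eta> - C (F (C \<eta> \<xi>)) \<zeta>"
    using v_curvature_eq assms(9-11) by blast
  moreover have "v_curvature A D_Hashiguchi \<zeta> \<eta> \<xi> = C (F (C \<zeta> \<xi>)) \<eta> - C (F (C \<eta> \<xi>)) \<zeta>"
    using v_curvature_eq[OF D_linear D_J_J assms(9-11)] .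
  ultimately show ?thesis
    using h_curvature_eq[OF assms(9-11)] hv_curvature_eq[OF assms(9-11)] by simp
qed

end
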